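(* Let $F(z)=D+C(zI-A)^{-1}B$ with $(C,A)$ observable. Assume that the columns of $H_{fzk}(zI-\Lambda_{fzk})^{-1}$ provide a basis in $Z(F)\oplus\mathcal W(\ker F)$, and let $\Pi_{fzk}$ be the corresponding solution of $A\Pi_{fzk}+BH_{fzk}=\Pi_{fzk}\Lambda_{fzk}$, $C\Pi_{fzk}+DH_{fzk}=0$. Consider a maximal solution $(R_0,\alpha_0)$ (in the sense of inclusion of $\operatorname{Im}R_0$) of $BR_0=\Pi_{fzk}\alpha_0$, $DR_0=0$, where the column vectors of $R_0$ are orthonormal. Then there exists a matrix $\beta$ such that the function $$K_\beta(z)=R_0+(H_{fzk}+R_0\beta)\bigl(zI-(\Lambda_{fzk}+\alpha_0\beta)\bigr)^{-1}\alpha_0$$ is a tall inner function (in the continuous-time sense).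
   Context: $A\in\mathbb C^{n\times n}$, $B\in\mathbb C^{n\times q}$, $C\in\mathbb C^{p\times n}$, $D\in\mathbb C^{p\times q}$. $\Omega U=\mathbb C[z]^q$, $\Omega Y=\mathbb C[z]^p$; $z^{-1}\Omega_\infty U$ is the set of strictly proper rational $q$-tuples; $\ker F=\{g\in\mathbb C(z)^q:Fg=0\}$; $F^{-1}(\Omega Y)=\{g\in\mathbb C(z)^q:Fg\in\Omega Y\}$; $\pi_-$ takes the strictly proper part. $Z(F)=(F^{-1}(\Omega Y)+\Omega U)/(\ker F+\Omega U)$, $\mathcal W(\ker F)=\pi_-(\ker F)/(\ker F\cap z^{-1}\Omega_\infty U)$. The space $Z(F)\oplus\mathcal W(\ker F)$ is identified with the space of strictly proper elements of $F^{-1}(\Omega Y)+\Omega U$ modulo $\ker F\cap z^{-1}\Omega_\infty U$; "the columns provide a basis" means they belong to $F^{-1}(\Omega Y)+\Omega U$ and their classes form a basis of this quotient. Such a basis determines a unique solution $\Pi_{fzk}$, and it has trivial kernel. A rational matrix function $K$ is tall inner in the continuous-time sense if it is analytic in the right half-plane and $K^*(z)K(z)=I$, where $K^*(z)=(K(-\bar z))^*$ is the para-hermitian conjugate. *)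

theory Defs
  imports
    "HOL-Computational_Algebra.Polynomial_Factorial"
    "HOL-Computational_Algebra.Field_as_Ring"
    "HOL-Analysis.Complex_Analysis_Basics"
    "Jordan_Normal_Form.Schur_Decomposition"
    "Jordan_Normal_Form.Gauss_Jordan_Elimination"
    "Jordan_Normal_Form.Matrix_Kernel"
begin

unbundle no vec_syntax

type_synonym ratfun = "complex poly fract"

definition rat_const :: "complex \<Rightarrow> ratfun" where
  "rat_const c = to_fract [:c:]"

definition rat_z :: ratfun where
  "rat_z = to_fract [:0, 1:]"

text \<open>The pair \<open>quot_of_fract r\<close> is the reduced representation of \<open>r\<close>, so the zeros of its second
  component are exactly the poles of \<open>r\<close>.\<close>

definition rat_pole :: "ratfun \<Rightarrow> complex \<Rightarrow> bool" where
  "rat_pole r z \<longleftrightarrow> poly (snd (quot_of_fract r)) z = 0"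

text \<open>At a pole the value is \<open>0\<close> because of division by zero, while \<open>r\<close> is unbounded nearby. Hence
  \<open>rat_eval r\<close> is analytic on an open set if and only if \<open>r\<close> has no poles there, and removable
  singularities of unreduced representations play no role.\<close>

definition rat_eval :: "ratfun \<Rightarrow> complex \<Rightarrow> complex" where
  "rat_eval r z = poly (fst (quot_of_fract r)) z / poly (snd (quot_of_fract r)) z"

definition strictly_proper :: "ratfun \<Rightarrow> bool" where
  "strictly_proper r \<longleftrightarrow>
     r = 0 \<or> degree (fst (quot_of_fract r)) < degree (snd (quot_of_fract r))"

definition poly_vecs :: "nat \<Rightarrow> ratfun vec set" where
  "poly_vecs d = {g \<in> carrier_vec d. \<forall>i<d. g $ i \<in> range to_fract}"

definition strictly_proper_vecs :: "nat \<Rightarrow> ratfun vec set" where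
  "strictly_proper_vecs d = {g \<in> carrier_vec d. \<forall>i<d. strictly_proper (g $ i)}"

definition poly_preimage :: "ratfun mat \<Rightarrow> ratfun vec set" where
  "poly_preimage F = {g \<in> carrier_vec (dim_col F). F *\<^sub>v g \<in> poly_vecs (dim_row F)}"

text \<open>\<open>Z(F) \<oplus> W(ker F)\<close> is the quotient of \<open>fzk_space F\<close>, the strictly proper elements of
  \<open>F\<^sup>-\<^sup>1(\<Omega>Y) + \<Omega>U\<close>, by \<open>fzk_null F\<close>, the strictly proper elements of \<open>ker F\<close>.\<close>

definition fzk_space :: "ratfun mat \<Rightarrow> ratfun vec set" where
  "fzk_space F =
     {g + u | g u. g \<in> poly_preimage F \<and> u \<in> poly_vecs (dim_col F)}
       \<inter> strictly_proper_vecs (dim_col F)"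

definition fzk_null :: "ratfun mat \<Rightarrow> ratfun vec set" where
  "fzk_null F = mat_kernel F \<inter> strictly_proper_vecs (dim_col F)"

text \<open>The columns of \<open>M\<close> lie in \<open>V\<close> and their classes form a basis of \<open>V / N\<close> over the
  complex numbers; \<open>M *\<^sub>v map_vec rat_const c\<close> is the combination of the columns with
  constant coefficients \<open>c\<close>.\<close>

definition cols_basis_mod :: "ratfun vec set \<Rightarrow> ratfun vec set \<Rightarrow> ratfun mat \<Rightarrow> bool" where
  "cols_basis_mod V N M \<longleftrightarrow>
     set (cols M) \<subseteq> V \<and>
     (\<forall>c \<in> carrier_vec (dim_col M).
        M *\<^sub>v map_vec rat_const c \<in> N \<longrightarrow> c = 0\<^sub>v (dim_col M)) \<and>
     (\<forall>g \<in> V. \<exists>c \<in> carrier_vec (dim_col M). g - M *\<^sub>v map_vec rat_const c \<in> N)"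

text \<open>\<open>zI - L\<close> is invertible over the field of rational functions for every complex square
  matrix \<open>L\<close>, so \<open>the\<close> is always applied to a proper value.\<close>

definition resolvent :: "complex mat \<Rightarrow> ratfun mat" where
  "resolvent L = the (mat_inverse (rat_z \<cdot>\<^sub>m 1\<^sub>m (dim_row L) - map_mat rat_const L))"

definition transfer_fun ::
    "complex mat \<Rightarrow> complex mat \<Rightarrow> complex mat \<Rightarrow> complex mat \<Rightarrow> ratfun mat" where
  "transfer_fun A B C D =
     map_mat rat_const D + map_mat rat_const C * resolvent A * map_mat rat_const B"

text \<open>The observability matrix with block rows \<open>C A\<^sup>i\<close>, \<open>i < n\<close>, has trivial kernel.\<close>

definition observable_pair :: "complex mat \<Rightarrow> complex mat \<Rightarrow> bool" where
  "observable_pair C A \<longleftrightarrow>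
     (\<forall>x \<in> carrier_vec (dim_col A).
        (\<forall>i < dim_row A. (C * A ^\<^sub>m i) *\<^sub>v x = 0\<^sub>v (dim_row C)) \<longrightarrow> x = 0\<^sub>v (dim_col A))"

definition mat_image :: "complex mat \<Rightarrow> complex vec set" where
  "mat_image R = (\<lambda>x. R *\<^sub>v x) ` carrier_vec (dim_col R)"

definition kernel_solution ::
    "complex mat \<Rightarrow> complex mat \<Rightarrow> complex mat \<Rightarrow> nat \<Rightarrow> complex mat \<Rightarrow> complex mat \<Rightarrow> bool" where
  "kernel_solution B D P m R \<alpha> \<longleftrightarrow>
     R \<in> carrier_mat (dim_col B) m \<and> \<alpha> \<in> carrier_mat (dim_col P) m \<and>
     B * R = P * \<alpha> \<and> D * R = 0\<^sub>m (dim_row D) m"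

definition maximal_orthonormal_solution ::
    "complex mat \<Rightarrow> complex mat \<Rightarrow> complex mat \<Rightarrow> nat \<Rightarrow> complex mat \<Rightarrow> complex mat \<Rightarrow> bool" where
  "maximal_orthonormal_solution B D P m R\<^sub>0 \<alpha>\<^sub>0 \<longleftrightarrow>
     kernel_solution B D P m R\<^sub>0 \<alpha>\<^sub>0 \<and>
     mat_adjoint R\<^sub>0 * R\<^sub>0 = 1\<^sub>m m \<and>
     (\<forall>l R \<alpha>. kernel_solution B D P l R \<alpha> \<and> mat_image R\<^sub>0 \<subseteq> mat_image R
        \<longrightarrow> mat_image R = mat_image R\<^sub>0)"

definition mat_eval :: "ratfun mat \<Rightarrow> complex \<Rightarrow> complex mat" where
  "mat_eval K z = map_mat (\<lambda>r. rat_eval r z) K"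

definition mat_pole :: "ratfun mat \<Rightarrow> complex \<Rightarrow> bool" where
  "mat_pole K z \<longleftrightarrow> (\<exists>r \<in> elements_mat K. rat_pole r z)"

definition para_hermitian :: "ratfun mat \<Rightarrow> complex \<Rightarrow> complex mat" where
  "para_hermitian K z = mat_adjoint (mat_eval K (- cnj z))"

definition tall_inner :: "ratfun mat \<Rightarrow> bool" where
  "tall_inner K \<longleftrightarrow>
     (\<forall>r \<in> elements_mat K. rat_eval r analytic_on {z. 0 < Re z}) \<and>
     (\<forall>z. \<not> mat_pole K z \<and> \<not> mat_pole K (- cnj z)
        \<longrightarrow> para_hermitian K z * mat_eval K z = 1\<^sub>m (dim_col K))"

end

theory Submission
  imports Defs
begin

text \<open>
  Inner-ness of \<open>K\<^sub>\<beta>\<close> is an energy balance. Write \<open>R\<close>, \<open>\<alpha>\<close> for \<open>R\<^sub>0\<close>, \<open>\<alpha>\<^sub>0\<close> and put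
  \<open>A = \<Lambda> - \<alpha> R\<^sup>\<dagger> H\<close> and \<open>G = H - R R\<^sup>\<dagger> H\<close>; since the columns of \<open>R\<close> are orthonormal, \<open>R\<^sup>\<dagger> G = 0\<close>.
  Suppose that \<open>X\<close> is positive semidefinite and solves the Riccati equation
  \<open>X A + A\<^sup>\<dagger> X - X \<alpha> \<alpha>\<^sup>\<dagger> X + G\<^sup>\<dagger> G = 0\<close>, and let \<open>\<beta> = - (R\<^sup>\<dagger> H + \<alpha>\<^sup>\<dagger> X)\<close>. With the states
  \<open>y(z) = (z I - \<Lambda> - \<alpha> \<beta>)\<^sup>-\<^sup>1 \<alpha> u\<close> and \<open>y'(w) = (w I - \<Lambda> - \<alpha> \<beta>)\<^sup>-\<^sup>1 \<alpha> u'\<close> one computes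
  \<open>\<langle>K\<^sub>\<beta>(z) u, K\<^sub>\<beta>(w) u'\<rangle> = \<langle>u, u'\<rangle> - (z + cnj w) \<langle>X y(z), y'(w)\<rangle>\<close>.
  For \<open>w = - cnj z\<close> the last term disappears, which is \<open>K\<^sub>\<beta>\<^sup>* K\<^sub>\<beta> = I\<close>. For \<open>w = z\<close> in the right
  half-plane it is nonpositive, so \<open>K\<^sub>\<beta>\<close> is contractive there; a rational function that is bounded
  near a point has no pole at it, hence \<open>K\<^sub>\<beta>\<close> is analytic. The eigenvalues of \<open>\<Lambda> + \<alpha> \<beta>\<close> never
  have to be located.

  The Riccati equation need not have a positive semidefinite solution on the whole state space,
  because unstable modes that \<open>\<alpha>\<close> does not reach may be visible in the output. Such modes do not
  enter the transfer function. Let \<open>F\<close> be the orthogonal projection onto the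
  orthogonal complement of the reachable space, the span of all \<open>A\<^sup>j \<alpha> u\<close>. It is enough to solve
  the equation with \<open>A (I - F)\<close> and \<open>G (I - F)\<close> in place of \<open>A\<close> and \<open>G\<close>, among the \<open>X\<close> with
  \<open>F X = 0\<close>, because \<open>F y(z) = 0\<close>.

  That solution is found by maximising the trace over the positive semidefinite \<open>X\<close> with
  \<open>F X = 0\<close> whose Riccati residual is positive semidefinite. The trace is bounded: otherwise
  normalised elements of this set converge to some \<open>Y \<noteq> 0\<close> with \<open>\<alpha>\<^sup>\<dagger> Y = 0\<close> and
  \<open>Y A + A\<^sup>\<dagger> Y\<close> positive semidefinite, so the kernel of \<open>Y\<close> is invariant and contains the reachable
  space, which together with \<open>F Y = 0\<close> gives \<open>Y = 0\<close> (\<open>riccati_subsolution_bounded\<close>). A maximiser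
  exists by compactness (\<open>max_trace_attained\<close>), and its residual vanishes, because a nonzero
  residual leaves room for a rank-one increment (\<open>riccati_subsolution_improve\<close>). The energy
  balance is \<open>inner_feedback_exists\<close>, and \<open>tall_innerI\<close> passes from the complement of a finite
  set of points to the definition of an inner function.
\<close>

section \<open>Adjoints and the standard inner product\<close>

notation mat_adjoint ("(_\<^sup>\<dagger>)" [1000] 1000)

lemma adjoint_dim [simp]: "dim_row (A\<^sup>\<dagger>) = dim_col A" "dim_col (A\<^sup>\<dagger>) = dim_row A"
  by (auto simp: mat_adjoint_def)

lemma adjoint_index [simp]:
  fixes A :: "complex mat"
  assumes "i < dim_col A" "j < dim_row A"
  shows "A\<^sup>\<dagger> $$ (i, j) = cnj (A $$ (j, i))"
  using assms by (simp add: mat_adjoint_def mat_of_rows_def)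

lemma adjoint_carrier: "A \<in> carrier_mat r c \<Longrightarrow> A\<^sup>\<dagger> \<in> carrier_mat c r"
  by (auto intro!: carrier_matI)

lemma adjoint_adjoint [simp]: "(A :: complex mat)\<^sup>\<dagger>\<^sup>\<dagger> = A"
  by (rule eq_matI) auto

lemma adjoint_add:
  fixes A B :: "complex mat"
  assumes "dim_row A = dim_row B" "dim_col A = dim_col B"
  shows "(A + B)\<^sup>\<dagger> = A\<^sup>\<dagger> + B\<^sup>\<dagger>"
  using assms by (intro eq_matI) auto

lemma adjoint_diff:
  fixes A B :: "complex mat"
  assumes "dim_row A = dim_row B" "dim_col A = dim_col B"
  shows "(A - B)\<^sup>\<dagger> = A\<^sup>\<dagger> - B\<^sup>\<dagger>"
  using assms by (intro eq_matI) auto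

lemma adjoint_mult:
  fixes A B :: "complex mat"
  assumes "dim_col A = dim_row B"
  shows "(A * B)\<^sup>\<dagger> = B\<^sup>\<dagger> * A\<^sup>\<dagger>"
  using assms by (intro eq_matI) (auto simp: scalar_prod_def mult.commute)

text \<open>The rules for matrices acting on vectors are stated with dimensions as premises, since
  equations between dimensions, unlike membership in a carrier, are decided by rewriting.\<close>

lemma add_mult_vec:
  fixes A B :: "complex mat"
  assumes "dim_row A = dim_row B" "dim_col A = dim_vec v" "dim_col B = dim_vec v"
  shows "(A + B) *\<^sub>v v = A *\<^sub>v v + B *\<^sub>v v"
  using assms by (intro eq_vecI) (auto simp: scalar_prod_def algebra_simps sum.distrib)

lemma diff_mult_vec:
  fixes A B :: "complex mat"
  assumes "dim_row A = dim_row B" "dim_col A = dim_vec v" "dim_col B = dim_vec v"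
  shows "(A - B) *\<^sub>v v = A *\<^sub>v v - B *\<^sub>v v"
  using assms by (intro eq_vecI) (auto simp: scalar_prod_def algebra_simps sum_subtractf)

lemma smult_mult_vec:
  fixes A :: "complex mat"
  assumes "dim_col A = dim_vec v"
  shows "(c \<cdot>\<^sub>m A) *\<^sub>v v = c \<cdot>\<^sub>v (A *\<^sub>v v)"
  using assms by (intro eq_vecI) (auto simp: scalar_prod_def algebra_simps sum_distrib_left)

lemma mult_mult_vec:
  fixes A B :: "complex mat"
  assumes "dim_col A = dim_row B" "dim_col B = dim_vec v"
  shows "(A * B) *\<^sub>v v = A *\<^sub>v (B *\<^sub>v v)"
  using assms by (intro assoc_mult_mat_vec[of _ "dim_row A" "dim_row B" _ "dim_vec v"])
    (auto intro!: carrier_matI carrier_vecI)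

lemma mult_vec_add:
  fixes A :: "complex mat"
  assumes "dim_vec v = dim_col A" "dim_vec w = dim_col A"
  shows "A *\<^sub>v (v + w) = A *\<^sub>v v + A *\<^sub>v w"
  using assms by (intro eq_vecI) (auto simp: scalar_prod_def algebra_simps sum.distrib)

lemma mult_vec_diff:
  fixes A :: "complex mat"
  assumes "dim_vec v = dim_col A" "dim_vec w = dim_col A"
  shows "A *\<^sub>v (v - w) = A *\<^sub>v v - A *\<^sub>v w"
  using assms by (intro eq_vecI) (auto simp: scalar_prod_def algebra_simps sum_subtractf)

lemma mult_vec_smult:
  fixes A :: "complex mat"
  assumes "dim_vec v = dim_col A"
  shows "A *\<^sub>v (c \<cdot>\<^sub>v v) = c \<cdot>\<^sub>v (A *\<^sub>v v)"
  using assms by (intro eq_vecI) (auto simp: scalar_prod_def algebra_simps sum_distrib_left)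

lemma mult_vec_zero:
  fixes A :: "complex mat"
  assumes "dim_col A = k"
  shows "A *\<^sub>v 0\<^sub>v k = 0\<^sub>v (dim_row A)"
  using assms by (intro eq_vecI) (auto simp: scalar_prod_def)

lemmas mat_vec_simps =
  add_mult_vec diff_mult_vec smult_mult_vec mult_mult_vec mult_vec_add mult_vec_diff mult_vec_smult

lemma cip_add_left:
  fixes u :: "complex vec"
  assumes "dim_vec u = dim_vec w" "dim_vec v = dim_vec w"
  shows "(u + v) \<bullet>c w = u \<bullet>c w + v \<bullet>c w"
  using assms by (auto simp: scalar_prod_def algebra_simps sum.distrib)

lemma cip_add_right:
  fixes u :: "complex vec"
  assumes "dim_vec u = dim_vec w" "dim_vec v = dim_vec w"
  shows "w \<bullet>c (u + v) = w \<bullet>c u + w \<bullet>c v"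
  using assms by (auto simp: scalar_prod_def algebra_simps sum.distrib)

lemma cip_diff_left:
  fixes u :: "complex vec"
  assumes "dim_vec u = dim_vec w" "dim_vec v = dim_vec w"
  shows "(u - v) \<bullet>c w = u \<bullet>c w - v \<bullet>c w"
  using assms by (auto simp: scalar_prod_def algebra_simps sum_subtractf)

lemma cip_diff_right:
  fixes u :: "complex vec"
  assumes "dim_vec u = dim_vec w" "dim_vec v = dim_vec w"
  shows "w \<bullet>c (u - v) = w \<bullet>c u - w \<bullet>c v"
  using assms by (auto simp: scalar_prod_def algebra_simps sum_subtractf)

lemma cip_smult_left:
  fixes u :: "complex vec"
  assumes "dim_vec u = dim_vec w"
  shows "(c \<cdot>\<^sub>v u) \<bullet>c w = c * (u \<bullet>c w)"
  using assms by (auto simp: scalar_prod_def algebra_simps sum_distrib_left)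

lemma cip_smult_right:
  fixes u :: "complex vec"
  assumes "dim_vec u = dim_vec w"
  shows "w \<bullet>c (c \<cdot>\<^sub>v u) = cnj c * (w \<bullet>c u)"
  using assms by (auto simp: scalar_prod_def algebra_simps sum_distrib_left)

lemmas cip_simps =
  cip_add_left cip_add_right cip_diff_left cip_diff_right cip_smult_left cip_smult_right

lemma cip_commute:
  fixes u :: "complex vec"
  assumes "dim_vec u = dim_vec w"
  shows "u \<bullet>c w = cnj (w \<bullet>c u)"
  using assms by (auto simp: scalar_prod_def algebra_simps)

lemma cip_zero [simp]:
  fixes u :: "complex vec"
  shows "dim_vec u = k \<Longrightarrow> u \<bullet> 0\<^sub>v k = 0" "dim_vec u = k \<Longrightarrow> 0\<^sub>v k \<bullet>c u = 0"
  by (auto simp: scalar_prod_def)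

lemma cip_adjoint:
  fixes A :: "complex mat"
  assumes "dim_vec v = dim_col A" "dim_vec w = dim_row A"
  shows "(A *\<^sub>v v) \<bullet>c w = v \<bullet>c (A\<^sup>\<dagger> *\<^sub>v w)"
proof -
  have "(A *\<^sub>v v) \<bullet>c w = (\<Sum>i<dim_row A. \<Sum>j<dim_col A. A $$ (i, j) * v $ j * cnj (w $ i))"
    using assms by (auto simp: scalar_prod_def sum_distrib_right atLeast0LessThan)
  also have "\<dots> = (\<Sum>j<dim_col A. \<Sum>i<dim_row A. A $$ (i, j) * v $ j * cnj (w $ i))"
    by (rule sum.swap)
  also have "\<dots> = v \<bullet>c (A\<^sup>\<dagger> *\<^sub>v w)"
    using assms
    by (auto simp: scalar_prod_def sum_distrib_left atLeast0LessThan mult_ac intro!: sum.cong)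
  finally show ?thesis .
qed

definition sq_norm_vec :: "complex vec \<Rightarrow> real" where
  "sq_norm_vec v = Re (v \<bullet>c v)"

lemma sq_norm_vec_sum: "sq_norm_vec v = (\<Sum>i<dim_vec v. (cmod (v $ i))\<^sup>2)"
  by (auto simp: sq_norm_vec_def scalar_prod_def atLeast0LessThan complex_mult_cnj cmod_def intro!: sum.cong)

lemma sq_norm_vec_ge0 [simp]: "0 \<le> sq_norm_vec v"
  by (simp add: sq_norm_vec_sum sum_nonneg)

lemma sq_norm_vec_eq0: "sq_norm_vec v = 0 \<longleftrightarrow> v = 0\<^sub>v (dim_vec v)"
  by (auto simp: sq_norm_vec_sum sum_nonneg_eq_0_iff)
    (metis eq_vecI index_zero_vec lessThan_iff)

lemma cip_self: "(v :: complex vec) \<bullet>c v = of_real (sq_norm_vec v)"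
proof -
  have "Im (v \<bullet>c v) = 0"
    by (simp add: scalar_prod_def)
  then show ?thesis
    by (simp add: sq_norm_vec_def complex_eq_iff)
qed

lemma eq_zero_if_cip_zero:
  assumes "\<And>w. dim_vec w = dim_vec v \<Longrightarrow> v \<bullet>c w = (0::complex)"
  shows "v = 0\<^sub>v (dim_vec v)"
  using assms[of v] sq_norm_vec_eq0[of v] by (simp add: sq_norm_vec_def)

lemma mult_unit_vec_index:
  fixes A :: "complex mat"
  assumes "i < dim_row A" "j < dim_col A"
  shows "(A *\<^sub>v unit_vec (dim_col A) j) $ i = A $$ (i, j)"
  using assms scalar_prod_right_unit[of j "dim_col A" "row A i"] by auto

lemma mat_eq_if_mult_vec_eq:
  fixes A B :: "complex mat"
  assumes A: "A \<in> carrier_mat r c" and B: "B \<in> carrier_mat r c"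
    and eq: "\<And>x. dim_vec x = c \<Longrightarrow> A *\<^sub>v x = B *\<^sub>v x"
  shows "A = B"
proof (rule eq_matI)
  fix i j assume "i < dim_row B" "j < dim_col B"
  then show "A $$ (i, j) = B $$ (i, j)"
    using mult_unit_vec_index[of i A j] mult_unit_vec_index[of i B j] eq[of "unit_vec c j"] A B by simp
qed (use A B in auto)

section \<open>Positive semidefinite matrices\<close>

definition psd :: "nat \<Rightarrow> complex mat \<Rightarrow> bool" where
  "psd k X \<longleftrightarrow> X \<in> carrier_mat k k \<and> X\<^sup>\<dagger> = X \<and> (\<forall>x. dim_vec x = k \<longrightarrow> 0 \<le> Re ((X *\<^sub>v x) \<bullet>c x))"

lemma psd_dim: "psd k X \<Longrightarrow> dim_row X = k" "psd k X \<Longrightarrow> dim_col X = k"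
  by (auto simp: psd_def)

lemma hermitian_cip:
  fixes X :: "complex mat"
  assumes "X\<^sup>\<dagger> = X" "dim_vec x = dim_col X" "dim_vec y = dim_row X"
  shows "(X *\<^sub>v x) \<bullet>c y = x \<bullet>c (X *\<^sub>v y)"
  using cip_adjoint[of x X y] assms by simp

lemma hermitian_form_real:
  fixes X :: "complex mat"
  assumes "X\<^sup>\<dagger> = X" "X \<in> carrier_mat k k" "dim_vec x = k"
  shows "(X *\<^sub>v x) \<bullet>c x = of_real (Re ((X *\<^sub>v x) \<bullet>c x))"
proof -
  have "(X *\<^sub>v x) \<bullet>c x = cnj ((X *\<^sub>v x) \<bullet>c x)"
    using hermitian_cip[of X x x] cip_commute[of x "X *\<^sub>v x"] assms by auto
  then show ?thesis
    by (metis Reals_cnj_iff complex_is_Real_iff of_real_Re)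
qed

text \<open>The form is nonnegative at every \<open>s x - t c y\<close>, where \<open>c = \<langle>X x, y\<rangle>\<close>. Since \<open>X\<close> may be
  singular, the case \<open>\<langle>X y, y\<rangle> = 0\<close> is separate: a large \<open>t\<close> then forces \<open>c = 0\<close>.\<close>

lemma psd_cauchy_schwarz:
  assumes X: "psd k X" and x: "dim_vec x = k" and y: "dim_vec y = k"
  shows "(cmod ((X *\<^sub>v x) \<bullet>c y))\<^sup>2 \<le> Re ((X *\<^sub>v x) \<bullet>c x) * Re ((X *\<^sub>v y) \<bullet>c y)"
proof -
  note d = psd_dim[OF X] x y
  have h: "X\<^sup>\<dagger> = X" using X by (auto simp: psd_def)
  define a where "a = Re ((X *\<^sub>v x) \<bullet>c x)"
  define b where "b = Re ((X *\<^sub>v y) \<bullet>c y)"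
  define c where "c = (X *\<^sub>v x) \<bullet>c y"
  have Xa: "(X *\<^sub>v x) \<bullet>c x = of_real a" and Xb: "(X *\<^sub>v y) \<bullet>c y = of_real b"
    using hermitian_form_real[OF h] X d by (auto simp: a_def b_def psd_def)
  have Xc: "(X *\<^sub>v y) \<bullet>c x = cnj c"
    unfolding c_def using hermitian_cip[OF h, of y x] cip_commute[of y "X *\<^sub>v x"] d by auto
  have n: "(complex_of_real (cmod c))\<^sup>2 = c * cnj c"
    by (simp add: complex_norm_square flip: of_real_power)
  have expand: "0 \<le> s * s * a - 2 * s * t * (cmod c)\<^sup>2 + t * t * (cmod c)\<^sup>2 * b" for s t :: real
  proof -
    define u where "u = complex_of_real s \<cdot>\<^sub>v x - (of_real t * c) \<cdot>\<^sub>v y"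
    have "0 \<le> Re ((X *\<^sub>v u) \<bullet>c u)"
      using X d by (auto simp: psd_def u_def)
    also have "(X *\<^sub>v u) \<bullet>c u
        = of_real s * of_real s * of_real a - of_real s * (of_real t * cnj c) * c
          - of_real t * c * of_real s * cnj c + of_real t * c * (of_real t * cnj c) * of_real b"
      using d by (simp add: u_def mat_vec_simps cip_simps Xa Xb Xc c_def[symmetric] algebra_simps)
    also have "\<dots> = of_real (s * s * a - 2 * s * t * (cmod c)\<^sup>2 + t * t * (cmod c)\<^sup>2 * b)"
      by (simp add: n[unfolded power2_eq_square] algebra_simps power2_eq_square)
    finally show ?thesis by simp
  qed
  have b0: "0 \<le> b"
    using X y by (auto simp: psd_def b_def)
  have "(cmod c)\<^sup>2 \<le> a * b"
  proof (cases "b = 0")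
    case True
    have "(cmod c)\<^sup>2 = 0"
    proof (rule ccontr)
      assume "(cmod c)\<^sup>2 \<noteq> 0"
      then show False
        using expand[of 1 "(a + 1) / (2 * (cmod c)\<^sup>2)"] True by (simp add: field_simps)
    qed
    then show ?thesis using True by simp
  next
    case False
    then have "0 \<le> b * (a * b - (cmod c)\<^sup>2)"
      using expand[of b 1] by (simp add: algebra_simps)
    then show ?thesis
      using b0 False by (simp add: zero_le_mult_iff)
  qed
  then show ?thesis by (simp add: a_def b_def c_def)
qed

lemma psd_kernel:
  assumes X: "psd k X" and x: "dim_vec x = k" and 0: "Re ((X *\<^sub>v x) \<bullet>c x) = 0"
  shows "X *\<^sub>v x = 0\<^sub>v k"
  using eq_zero_if_cip_zero[of "X *\<^sub>v x"] psd_cauchy_schwarz[OF X x] 0 psd_dim[OF X] by simp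

lemma psd_eq_zero:
  assumes X: "psd k X" and "\<And>x. dim_vec x = k \<Longrightarrow> X *\<^sub>v x = 0\<^sub>v k"
  shows "X = 0\<^sub>m k k"
  using assms by (intro mat_eq_if_mult_vec_eq[of _ k k]) (auto simp: psd_def)

definition re_trace :: "complex mat \<Rightarrow> real" where
  "re_trace X = (\<Sum>i<dim_row X. Re (X $$ (i, i)))"

lemma cip_unit_vec:
  fixes X :: "complex mat"
  assumes "X \<in> carrier_mat k k" "i < k" "j < k"
  shows "(X *\<^sub>v unit_vec k j) \<bullet>c unit_vec k i = X $$ (i, j)"
proof -
  have "conjugate (unit_vec k i) = (unit_vec k i :: complex vec)"
    by (intro eq_vecI) (auto simp: unit_vec_def)
  then show ?thesis
    using assms mult_unit_vec_index[of i X j] scalar_prod_right_unit[of i k "X *\<^sub>v unit_vec k j"] by simp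
qed

lemma psd_diag_nonneg:
  assumes "psd k X" "i < k"
  shows "0 \<le> Re (X $$ (i, i))"
proof -
  have "0 \<le> Re ((X *\<^sub>v unit_vec k i) \<bullet>c unit_vec k i)"
    using assms by (simp add: psd_def)
  then show ?thesis using assms cip_unit_vec[of X k i i] by (simp add: psd_def)
qed

text \<open>This bound makes the trace usable as a norm on the cone of positive semidefinite matrices.\<close>

lemma psd_entry_le_trace:
  assumes X: "psd k X" and ij: "i < k" "j < k"
  shows "cmod (X $$ (i, j)) \<le> re_trace X"
proof -
  have le: "Re (X $$ (l, l)) \<le> re_trace X" if "l < k" for l
    unfolding re_trace_def using that psd_dim[OF X] psd_diag_nonneg[OF X]
    by (intro member_le_sum) auto
  have c: "X \<in> carrier_mat k k" using X by (auto simp: psd_def)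
  have "(cmod (X $$ (i, j)))\<^sup>2 \<le> Re (X $$ (j, j)) * Re (X $$ (i, i))"
    using psd_cauchy_schwarz[OF X, of "unit_vec k j" "unit_vec k i"] ij cip_unit_vec[OF c] by simp
  also have "\<dots> \<le> re_trace X * re_trace X"
    using le ij psd_diag_nonneg[OF X] by (intro mult_mono) (auto intro: order_trans)
  finally show ?thesis
    using le[OF ij(1)] psd_diag_nonneg[OF X ij(1)] by (metis order_trans power2_eq_square power2_le_imp_le)
qed

section \<open>Entrywise limits and compactness\<close>

definition vec_tendsto :: "nat \<Rightarrow> (nat \<Rightarrow> complex vec) \<Rightarrow> complex vec \<Rightarrow> bool" where
  "vec_tendsto k v l \<longleftrightarrow> (\<forall>n. dim_vec (v n) = k) \<and> dim_vec l = k \<and> (\<forall>i<k. (\<lambda>n. v n $ i) \<longlonglongrightarrow> l $ i)"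

definition mat_tendsto :: "nat \<Rightarrow> (nat \<Rightarrow> complex mat) \<Rightarrow> complex mat \<Rightarrow> bool" where
  "mat_tendsto k X L \<longleftrightarrow> (\<forall>n. X n \<in> carrier_mat k k) \<and> L \<in> carrier_mat k k \<and>
     (\<forall>i<k. \<forall>j<k. (\<lambda>n. X n $$ (i, j)) \<longlonglongrightarrow> L $$ (i, j))"

lemma vec_tendsto_const: "dim_vec v = k \<Longrightarrow> vec_tendsto k (\<lambda>n. v) v"
  by (simp add: vec_tendsto_def)

lemma vec_tendsto_mult_const:
  assumes "vec_tendsto k v l" "dim_col A = k"
  shows "vec_tendsto (dim_row A) (\<lambda>n. A *\<^sub>v v n) (A *\<^sub>v l)"
  using assms unfolding vec_tendsto_def
  by (auto simp: scalar_prod_def intro!: tendsto_sum tendsto_mult)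

lemma vec_tendsto_mult:
  assumes "mat_tendsto k X L" "dim_vec x = k"
  shows "vec_tendsto k (\<lambda>n. X n *\<^sub>v x) (L *\<^sub>v x)"
proof -
  have d: "dim_row (X n) = k" "dim_col (X n) = k" "dim_row L = k" "dim_col L = k" for n
    using assms by (auto simp: mat_tendsto_def)
  show ?thesis
    using assms unfolding vec_tendsto_def mat_tendsto_def
    by (auto simp: scalar_prod_def d intro!: tendsto_sum tendsto_mult)
qed

lemma cip_tendsto:
  assumes "vec_tendsto k v l" "vec_tendsto k w l'"
  shows "(\<lambda>n. v n \<bullet>c w n) \<longlonglongrightarrow> l \<bullet>c l'"
  using assms unfolding vec_tendsto_def
  by (auto simp: scalar_prod_def intro!: tendsto_sum tendsto_mult tendsto_cnj)

lemma vec_tendsto_unique: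
  assumes "vec_tendsto k v l" "vec_tendsto k v l'"
  shows "l = l'"
  using assms unfolding vec_tendsto_def by (intro eq_vecI) (auto intro: LIMSEQ_unique)

lemma cip_tendsto_const:
  assumes "mat_tendsto k X L" "dim_vec x = k" "dim_vec y = k"
  shows "(\<lambda>n. (X n *\<^sub>v x) \<bullet>c y) \<longlonglongrightarrow> (L *\<^sub>v x) \<bullet>c y"
  using assms by (intro cip_tendsto vec_tendsto_mult vec_tendsto_const)

lemma psd_limit:
  assumes X: "\<And>n. psd k (X n)" and lim: "mat_tendsto k X L"
  shows "psd k L"
proof -
  have L: "L \<in> carrier_mat k k" and d: "dim_row (X n) = k" "dim_col (X n) = k" for n
    using lim by (auto simp: mat_tendsto_def)
  have "L\<^sup>\<dagger> = L"
  proof (rule eq_matI)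
    fix i j assume ij: "i < dim_row L" "j < dim_col L"
    then have lt: "i < k" "j < k" using L by auto
    have "cnj (X n $$ (j, i)) = X n $$ (i, j)" for n
    proof -
      have "X n $$ (i, j) = (X n)\<^sup>\<dagger> $$ (i, j)" using X[of n] by (simp add: psd_def)
      then show ?thesis using lt d by simp
    qed
    then have "(\<lambda>n. X n $$ (i, j)) \<longlonglongrightarrow> cnj (L $$ (j, i))"
      using lim lt tendsto_cnj[of "\<lambda>n. X n $$ (j, i)" "L $$ (j, i)" sequentially]
      by (simp add: mat_tendsto_def)
    moreover have "(\<lambda>n. X n $$ (i, j)) \<longlonglongrightarrow> L $$ (i, j)"
      using lim lt by (simp add: mat_tendsto_def)
    ultimately have "cnj (L $$ (j, i)) = L $$ (i, j)"
      by (rule LIMSEQ_unique)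
    then show "L\<^sup>\<dagger> $$ (i, j) = L $$ (i, j)" using ij L by simp
  qed (use L in auto)
  moreover have "0 \<le> Re ((L *\<^sub>v x) \<bullet>c x)" if "dim_vec x = k" for x
    using tendsto_Re[OF cip_tendsto_const[OF lim that that]] X that
    by (intro LIMSEQ_le_const) (auto simp: psd_def)
  ultimately show ?thesis using L by (simp add: psd_def)
qed

lemma re_trace_tendsto:
  assumes "mat_tendsto k X L"
  shows "(\<lambda>n. re_trace (X n)) \<longlonglongrightarrow> re_trace L"
proof -
  have d: "dim_row (X n) = k" "dim_row L = k" for n
    using assms by (auto simp: mat_tendsto_def)
  show ?thesis
    using assms unfolding re_trace_def d mat_tendsto_def by (auto intro!: tendsto_sum tendsto_Re)
qed

lemma finite_family_convergent_subsequence: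
  fixes f :: "nat \<Rightarrow> 'i \<Rightarrow> complex"
  assumes "finite I" "\<And>n i. i \<in> I \<Longrightarrow> cmod (f n i) \<le> c"
  shows "\<exists>r l. strict_mono r \<and> (\<forall>i\<in>I. (\<lambda>n. f (r n) i) \<longlonglongrightarrow> l i)"
  using assms
proof (induction I rule: finite_induct)
  case empty
  show ?case by (rule exI[of _ id]) (simp add: strict_mono_def)
next
  case (insert a I)
  then have "\<exists>r l. strict_mono r \<and> (\<forall>i\<in>I. (\<lambda>n. f (r n) i) \<longlonglongrightarrow> l i)"
    by simp
  then obtain r l where r: "strict_mono r" "\<And>i. i \<in> I \<Longrightarrow> (\<lambda>n. f (r n) i) \<longlonglongrightarrow> l i"
    by blast
  have "bounded (range (\<lambda>n. f (r n) a))"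
    using insert.prems by (auto simp: bounded_iff)
  then obtain la s where s: "strict_mono s" "((\<lambda>n. f (r n) a) \<circ> s) \<longlonglongrightarrow> la"
    using bounded_imp_convergent_subsequence by blast
  have "(\<lambda>n. f (r (s n)) i) \<longlonglongrightarrow> (l(a := la)) i" if i: "i \<in> insert a I" for i
  proof (cases "i = a")
    case True
    then show ?thesis using s(2) by (simp add: o_def)
  next
    case False
    then have "i \<in> I" using i by simp
    from LIMSEQ_subseq_LIMSEQ[OF r(2)[OF this] s(1)] show ?thesis
      using False by (simp add: o_def)
  qed
  moreover have "strict_mono (\<lambda>n. r (s n))"
    using r(1) s(1) by (simp add: strict_mono_def)
  ultimately show ?case by blast
qed

lemma psd_bounded_trace_compact:
  fixes X :: "nat \<Rightarrow> complex mat"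
  assumes X: "\<And>n. psd k (X n)" and c: "\<And>n. re_trace (X n) \<le> c"
  obtains r L where "strict_mono r" "mat_tendsto k (\<lambda>n. X (r n)) L" "psd k L"
proof -
  have "cmod (X n $$ ij) \<le> c" if "ij \<in> {..<k} \<times> {..<k}" for n ij
    using psd_entry_le_trace[OF X[of n], of "fst ij" "snd ij"] c[of n] that by auto
  then obtain r l where r: "strict_mono r"
      "\<forall>ij\<in>{..<k} \<times> {..<k}. (\<lambda>n. X (r n) $$ ij) \<longlonglongrightarrow> l ij"
    using finite_family_convergent_subsequence[of "{..<k} \<times> {..<k}" "\<lambda>n ij. X n $$ ij" c] by auto
  have "mat_tendsto k (\<lambda>n. X (r n)) (mat k k l)"
    using r X by (auto simp: mat_tendsto_def psd_def)
  then show ?thesis using that[OF r(1)] psd_limit[OF X] by simp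
qed

text \<open>Trace maximisation is used twice: for the Riccati equation and for the construction of an
  orthogonal projection. In both cases a matrix that lacks the desired property can be
  increased by a rank-one matrix, so a maximiser has it.\<close>

lemma max_trace_attained:
  assumes ne: "X\<^sub>0 \<in> S" and bounded: "\<And>X. X \<in> S \<Longrightarrow> psd k X \<and> re_trace X \<le> c"
    and closed: "\<And>X L. (\<And>n. X n \<in> S) \<Longrightarrow> mat_tendsto k X L \<Longrightarrow> L \<in> S"
  obtains X where "X \<in> S" "\<And>Y. Y \<in> S \<Longrightarrow> re_trace Y \<le> re_trace X"
proof -
  define s where "s = (SUP X\<in>S. re_trace X)"
  have bdd: "bdd_above (re_trace ` S)"
    using bounded by (auto intro!: bdd_aboveI)
  have "\<exists>X\<in>S. s - 1 / real (Suc n) < re_trace X" for n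
    using less_cSUP_iff[OF _ bdd, of "s - 1 / real (Suc n)"] ne by (auto simp: s_def)
  then have "\<forall>n. \<exists>X. X \<in> S \<and> s - 1 / real (Suc n) < re_trace X" by blast
  from choice[OF this] obtain X where X: "X n \<in> S" "s - 1 / real (Suc n) < re_trace (X n)" for n
    by blast
  have le: "re_trace Y \<le> s" if "Y \<in> S" for Y
    unfolding s_def using bdd that by (rule cSUP_upper2) auto
  obtain r L where r: "strict_mono r" and lim: "mat_tendsto k (\<lambda>n. X (r n)) L"
  proof (rule psd_bounded_trace_compact[of k X c])
    show "psd k (X n)" "re_trace (X n) \<le> c" for n using X(1) bounded by auto
  qed blast
  have "(\<lambda>n. s - 1 / real (Suc n)) \<longlonglongrightarrow> s - 0"
    by (intro tendsto_diff tendsto_const LIMSEQ_Suc[OF lim_1_over_n])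
  then have lower: "(\<lambda>n. s - 1 / real (Suc n)) \<longlonglongrightarrow> s" by simp
  have "(\<lambda>n. re_trace (X n)) \<longlonglongrightarrow> s"
  proof (rule real_tendsto_sandwich[OF _ _ lower tendsto_const])
    show "\<forall>\<^sub>F n in sequentially. s - 1 / real (Suc n) \<le> re_trace (X n)"
      using X(2) by (intro always_eventually allI less_imp_le)
    show "\<forall>\<^sub>F n in sequentially. re_trace (X n) \<le> s"
      using le[OF X(1)] by simp
  qed
  from LIMSEQ_subseq_LIMSEQ[OF this r] have "(\<lambda>n. re_trace (X (r n))) \<longlonglongrightarrow> s"
    by (simp add: o_def)
  then have "re_trace L = s"
    using re_trace_tendsto[OF lim] LIMSEQ_unique by blast
  moreover have "L \<in> S" using closed[OF _ lim] X(1) by simp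
  ultimately show ?thesis using that[of L] le by simp
qed

section \<open>Resolvents and rank-one matrices\<close>

lemma semiring_hom_poly: "semiring_hom (\<lambda>p :: complex poly. poly p z)"
  by unfold_locales auto

lemma semiring_hom_to_fract: "semiring_hom (to_fract :: complex poly \<Rightarrow> ratfun)"
  by unfold_locales auto

text \<open>By Cramer's rule the resolvent of \<open>L\<close> is this polynomial matrix divided by the
  characteristic polynomial. The same numerator serves the resolvent over the field of rational
  functions and its values at complex numbers, so evaluation commutes with inversion.\<close>

definition resolvent_num :: "complex mat \<Rightarrow> complex poly mat" where
  "resolvent_num L = adj_mat (char_poly_matrix L)"

lemma resolvent_num:
  assumes "L \<in> carrier_mat k k"
  shows "resolvent_num L \<in> carrier_mat k k"
    "char_poly_matrix L * resolvent_num L = char_poly L \<cdot>\<^sub>m 1\<^sub>m k"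
    "resolvent_num L * char_poly_matrix L = char_poly L \<cdot>\<^sub>m 1\<^sub>m k"
  using adj_mat[OF char_poly_matrix_closed[OF assms]]
  by (auto simp: resolvent_num_def char_poly_def)

lemma char_poly_nonzero:
  assumes "(L :: complex mat) \<in> carrier_mat k k"
  shows "char_poly L \<noteq> 0"
  using degree_monic_char_poly[OF assms] by auto

definition resolvent_at :: "complex mat \<Rightarrow> complex \<Rightarrow> complex mat" where
  "resolvent_at L z = (1 / poly (char_poly L) z) \<cdot>\<^sub>m map_mat (\<lambda>p. poly p z) (resolvent_num L)"

lemma resolvent_at:
  assumes L: "L \<in> carrier_mat k k" and z: "poly (char_poly L) z \<noteq> 0"
  shows "resolvent_at L z \<in> carrier_mat k k"
    "(z \<cdot>\<^sub>m 1\<^sub>m k - L) * resolvent_at L z = 1\<^sub>m k"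
    "resolvent_at L z * (z \<cdot>\<^sub>m 1\<^sub>m k - L) = 1\<^sub>m k"
proof -
  let ?c = "1 / poly (char_poly L) z" and ?N = "map_mat (\<lambda>p. poly p z) (resolvent_num L)"
  have N: "?N \<in> carrier_mat k k" using resolvent_num(1)[OF L] by auto
  have C: "map_mat (\<lambda>p. poly p z) (char_poly_matrix L) = z \<cdot>\<^sub>m 1\<^sub>m k - L"
    using L by (intro eq_matI) (auto simp: char_poly_matrix_def)
  have S: "map_mat (\<lambda>p. poly p z) (char_poly L \<cdot>\<^sub>m 1\<^sub>m k) = poly (char_poly L) z \<cdot>\<^sub>m 1\<^sub>m k"
    by (intro eq_matI) auto
  have Z: "z \<cdot>\<^sub>m 1\<^sub>m k - L \<in> carrier_mat k k" using L by auto
  show "resolvent_at L z \<in> carrier_mat k k" using N by (simp add: resolvent_at_def)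
  have "(z \<cdot>\<^sub>m 1\<^sub>m k - L) * ?N = poly (char_poly L) z \<cdot>\<^sub>m 1\<^sub>m k"
    using semiring_hom.mat_hom_mult[OF semiring_hom_poly[of z]  char_poly_matrix_closed[OF L] resolvent_num(1)[OF L]]
    by (simp add: C S resolvent_num(2)[OF L])
  then show "(z \<cdot>\<^sub>m 1\<^sub>m k - L) * resolvent_at L z = 1\<^sub>m k"
    using z mult_smult_distrib[OF Z N, of ?c] by (auto simp: resolvent_at_def intro!: eq_matI)
  have "?N * (z \<cdot>\<^sub>m 1\<^sub>m k - L) = poly (char_poly L) z \<cdot>\<^sub>m 1\<^sub>m k"
    using semiring_hom.mat_hom_mult[OF semiring_hom_poly[of z]  resolvent_num(1)[OF L] char_poly_matrix_closed[OF L]]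
    by (simp add: C S resolvent_num(3)[OF L])
  then show "resolvent_at L z * (z \<cdot>\<^sub>m 1\<^sub>m k - L) = 1\<^sub>m k"
    using z mult_smult_assoc_mat[OF N Z, of ?c] by (auto simp: resolvent_at_def intro!: eq_matI)
qed

lemma one_mult_vec: "dim_vec v = k \<Longrightarrow> 1\<^sub>m k *\<^sub>v v = (v :: complex vec)"
  by (rule one_mult_mat_vec) (rule carrier_vecI)

lemma smult_zero_vec [simp]: "c \<cdot>\<^sub>v 0\<^sub>v k = (0\<^sub>v k :: complex vec)"
  by (intro eq_vecI) auto

lemma shifted_solve:
  assumes M: "(M :: complex mat) \<in> carrier_mat k k"
  obtains s :: real where "0 < s" "\<And>r. dim_vec r = k \<Longrightarrow> \<exists>v. dim_vec v = k \<and> M *\<^sub>v v = of_real s \<cdot>\<^sub>v v + r"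
proof -
  let ?bad = "{z. poly (char_poly M) z = 0}"
  have "finite ?bad" using poly_roots_finite[OF char_poly_nonzero[OF M]] .
  then have "finite (complex_of_real -` ?bad)" by (intro finite_vimageI) (auto simp: inj_def)
  then have "\<not> {0<..} \<subseteq> complex_of_real -` ?bad"
    using infinite_Ioi[of "0::real"] finite_subset by blast
  then obtain s :: real where s: "0 < s" "poly (char_poly M) (of_real s) \<noteq> 0" by auto
  let ?G = "resolvent_at M (of_real s)"
  note G = resolvent_at[OF M s(2)]
  have "\<exists>v. dim_vec v = k \<and> M *\<^sub>v v = of_real s \<cdot>\<^sub>v v + r" if r: "dim_vec r = k" for r
  proof -
    define v where "v = ?G *\<^sub>v (- r)"
    have d: "dim_vec v = k" using G by (simp add: v_def)
    have "(of_real s \<cdot>\<^sub>m 1\<^sub>m k - M) *\<^sub>v v = (of_real s \<cdot>\<^sub>m 1\<^sub>m k - M) * ?G *\<^sub>v (- r)"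
      unfolding v_def using G M r by (subst mult_mult_vec) auto
    also have "\<dots> = - r"
      using r by (simp add: G(2) one_mult_vec)
    finally have "of_real s \<cdot>\<^sub>v v - M *\<^sub>v v = - r"
      using d M by (simp add: diff_mult_vec smult_mult_vec one_mult_vec)
    then have "of_real s * v $ i - (M *\<^sub>v v) $ i = - r $ i" if "i < k" for i
      using that d M r by (metis carrier_matD(1) dim_mult_mat_vec index_minus_vec(1) index_smult_vec(1)
          index_uminus_vec(1))
    then have "M *\<^sub>v v = of_real s \<cdot>\<^sub>v v + r"
      using d r M by (intro eq_vecI) (auto simp: algebra_simps)
    then show ?thesis using d by blast
  qed
  then show ?thesis using that s(1) by blast
qed

definition outer :: "complex vec \<Rightarrow> complex mat" where
  "outer v = mat (dim_vec v) (dim_vec v) (\<lambda>(i, j). v $ i * cnj (v $ j))"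

lemma outer_carrier: "dim_vec v = k \<Longrightarrow> outer v \<in> carrier_mat k k"
  by (simp add: outer_def)

lemma outer_mult_vec: "dim_vec x = dim_vec v \<Longrightarrow> outer v *\<^sub>v x = (x \<bullet>c v) \<cdot>\<^sub>v v"
  by (intro eq_vecI) (auto simp: outer_def scalar_prod_def sum_distrib_left sum_distrib_right mult_ac)

lemma re_trace_outer: "re_trace (outer v) = sq_norm_vec v"
  by (auto simp: re_trace_def outer_def sq_norm_vec_sum cmod_def power2_eq_square intro!: sum.cong)

lemma re_trace_add_smult:
  assumes "X \<in> carrier_mat k k" "Y \<in> carrier_mat k k"
  shows "re_trace (X + of_real c \<cdot>\<^sub>m Y) = re_trace X + c * re_trace Y"
  using assms by (auto simp: re_trace_def sum.distrib sum_distrib_left)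

lemma psd_add_outer:
  assumes X: "psd k X" and v: "dim_vec v = k" and c: "0 \<le> c"
  shows "psd k (X + of_real c \<cdot>\<^sub>m outer v)"
  unfolding psd_def
proof (intro conjI allI impI)
  note d = psd_dim[OF X] v outer_carrier[OF v]
  have h: "X\<^sup>\<dagger> = X" using X by (auto simp: psd_def)
  show "X + of_real c \<cdot>\<^sub>m outer v \<in> carrier_mat k k" using d by auto
  have "(of_real c \<cdot>\<^sub>m outer v)\<^sup>\<dagger> = of_real c \<cdot>\<^sub>m outer v"
    by (intro eq_matI) (auto simp: outer_def)
  then show "(X + of_real c \<cdot>\<^sub>m outer v)\<^sup>\<dagger> = X + of_real c \<cdot>\<^sub>m outer v"
    using h d by (simp add: adjoint_add)
  fix x :: "complex vec" assume x: "dim_vec x = k"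
  have "((X + of_real c \<cdot>\<^sub>m outer v) *\<^sub>v x) \<bullet>c x
      = (X *\<^sub>v x) \<bullet>c x + of_real c * ((x \<bullet>c v) * cnj (x \<bullet>c v))"
    using d x cip_commute[of v x] by (simp add: mat_vec_simps cip_simps outer_mult_vec)
  also have "\<dots> = (X *\<^sub>v x) \<bullet>c x + of_real (c * (cmod (x \<bullet>c v))\<^sup>2)"
    by (simp only: complex_norm_square of_real_mult)
  finally show "0 \<le> Re (((X + of_real c \<cdot>\<^sub>m outer v) *\<^sub>v x) \<bullet>c x)"
    using X x c by (simp add: psd_def)
qed

text \<open>For a normalised \<open>y\<close>, that is \<open>\<langle>T y, y\<rangle> = 1\<close>, the Cauchy-Schwarz inequality says that
  \<open>T - (T y) (T y)\<^sup>\<dagger>\<close> is still positive semidefinite.\<close>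

lemma psd_dominates_rank_one:
  assumes T: "psd k T" and "T \<noteq> 0\<^sub>m k k"
  obtains y where "dim_vec y = k" "T *\<^sub>v y \<noteq> 0\<^sub>v k"
    "\<And>x. dim_vec x = k \<Longrightarrow> (cmod (x \<bullet>c (T *\<^sub>v y)))\<^sup>2 \<le> Re ((T *\<^sub>v x) \<bullet>c x)"
proof -
  note d = psd_dim[OF T]
  have h: "T\<^sup>\<dagger> = T" using T by (auto simp: psd_def)
  obtain y where y: "dim_vec y = k" "T *\<^sub>v y \<noteq> 0\<^sub>v k"
    using psd_eq_zero[OF T] assms(2) by blast
  define \<tau> where "\<tau> = Re ((T *\<^sub>v y) \<bullet>c y)"
  have pos: "0 < \<tau>"
  proof -
    have "\<tau> \<noteq> 0" using psd_kernel[OF T y(1)] y(2) by (auto simp: \<tau>_def)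
    moreover have "0 \<le> \<tau>" using T y(1) by (simp add: psd_def \<tau>_def)
    ultimately show ?thesis by simp
  qed
  define w where "w = of_real (1 / sqrt \<tau>) \<cdot>\<^sub>v y"
  have Tw: "T *\<^sub>v w = of_real (1 / sqrt \<tau>) \<cdot>\<^sub>v (T *\<^sub>v y)"
    using d y by (simp add: w_def mat_vec_simps)
  have "T *\<^sub>v y = of_real (sqrt \<tau>) \<cdot>\<^sub>v (T *\<^sub>v w)"
    using pos by (simp add: Tw smult_smult_assoc)
  then have "T *\<^sub>v w \<noteq> 0\<^sub>v k" using y(2) by auto
  moreover have "(cmod (x \<bullet>c (T *\<^sub>v w)))\<^sup>2 \<le> Re ((T *\<^sub>v x) \<bullet>c x)" if x: "dim_vec x = k" for x
  proof -
    have "x \<bullet>c (T *\<^sub>v w) = of_real (1 / sqrt \<tau>) * ((T *\<^sub>v x) \<bullet>c y)"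
      using d x y hermitian_cip[OF h, of x y] by (simp add: Tw cip_simps)
    then have "(cmod (x \<bullet>c (T *\<^sub>v w)))\<^sup>2 = (cmod ((T *\<^sub>v x) \<bullet>c y))\<^sup>2 / \<tau>"
      using pos by (simp add: norm_mult norm_divide power_divide power_mult_distrib)
    also have "\<dots> \<le> Re ((T *\<^sub>v x) \<bullet>c x)"
      using psd_cauchy_schwarz[OF T x y(1), folded \<tau>_def] pos by (simp add: pos_divide_le_eq)
    finally show ?thesis .
  qed
  moreover have "dim_vec w = k" using y(1) by (simp add: w_def)
  ultimately show ?thesis using that by blast
qed

section \<open>The Riccati equation\<close>

definition riccati_form :: "complex mat \<Rightarrow> complex mat \<Rightarrow> complex mat \<Rightarrow> complex mat \<Rightarrow> complex vec \<Rightarrow> real" where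
  "riccati_form A \<alpha> Q X x =
     2 * Re ((X *\<^sub>v x) \<bullet>c (A *\<^sub>v x)) - sq_norm_vec (\<alpha>\<^sup>\<dagger> *\<^sub>v (X *\<^sub>v x)) + Re ((Q *\<^sub>v x) \<bullet>c x)"

definition riccati_mat :: "complex mat \<Rightarrow> complex mat \<Rightarrow> complex mat \<Rightarrow> complex mat \<Rightarrow> complex mat" where
  "riccati_mat A \<alpha> Q X = X * A + A\<^sup>\<dagger> * X - X * (\<alpha> * (\<alpha>\<^sup>\<dagger> * X)) + Q"

text \<open>Unlike the equation, the inequality has an obvious solution, namely \<open>0\<close>. The condition
  \<open>F X = 0\<close> excludes the directions in which solutions could grow without bound.\<close>

definition riccati_subsolutions :: "nat \<Rightarrow> complex mat \<Rightarrow> complex mat \<Rightarrow> complex mat \<Rightarrow> complex mat \<Rightarrow> complex mat set" where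
  "riccati_subsolutions k F A \<alpha> Q = {X. psd k X \<and> (\<forall>x. dim_vec x = k \<longrightarrow> F *\<^sub>v (X *\<^sub>v x) = 0\<^sub>v k) \<and>
     (\<forall>x. dim_vec x = k \<longrightarrow> 0 \<le> riccati_form A \<alpha> Q X x)}"

lemma sq_norm_vec_smult: "sq_norm_vec (c \<cdot>\<^sub>v v) = (cmod c)\<^sup>2 * sq_norm_vec v"
  by (simp add: sq_norm_vec_sum norm_mult power_mult_distrib sum_distrib_left)

lemma psd_smult:
  assumes "psd k X" "0 \<le> c"
  shows "psd k (of_real c \<cdot>\<^sub>m X)"
proof -
  have h: "X\<^sup>\<dagger> = X" and d: "dim_row X = k" "dim_col X = k" using assms(1) by (auto simp: psd_def)
  have "cnj (X $$ (j, i)) = X $$ (i, j)" if "i < k" "j < k" for i j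
    using arg_cong[OF h, of "\<lambda>M. M $$ (i, j)"] that d by simp
  then have "(of_real c \<cdot>\<^sub>m X)\<^sup>\<dagger> = of_real c \<cdot>\<^sub>m X"
    using d by (intro eq_matI) auto
  then show ?thesis
    using assms d by (auto simp: psd_def smult_mult_vec cip_simps)
qed

lemma re_trace_smult: "re_trace (of_real c \<cdot>\<^sub>m X) = c * re_trace X" if "X \<in> carrier_mat k k"
  using that by (auto simp: re_trace_def sum_distrib_left)

text \<open>The Riccati inequality bounds a quadratic expression in \<open>X\<close> by a linear one. If the traces
  \<open>t\<close> were unbounded, a limit \<open>L\<close> of the matrices \<open>X / t\<close> would satisfy \<open>\<alpha>\<^sup>\<dagger> L = 0\<close>, because the
  quadratic part dominates, and \<open>L A + A\<^sup>\<dagger> L \<ge> 0\<close>, because the constant part disappears. On the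
  kernel of \<open>L\<close> the form of \<open>L A + A\<^sup>\<dagger> L\<close> vanishes, hence so does the matrix itself, and the kernel
  is invariant under \<open>A\<close>. The hypothesis \<open>reach\<close>, which expresses controllability up to \<open>F\<close>, excludes
  every such \<open>L\<close> but \<open>0\<close>, while the trace of \<open>L\<close> is \<open>1\<close>.\<close>

lemma riccati_subsolution_bounded:
  assumes A: "A \<in> carrier_mat k k" and \<alpha>: "\<alpha> \<in> carrier_mat k m" and Q: "psd k Q"
    and F: "F \<in> carrier_mat k k"
    and reach: "\<And>Y. psd k Y \<Longrightarrow> (\<And>x. dim_vec x = k \<Longrightarrow> F *\<^sub>v (Y *\<^sub>v x) = 0\<^sub>v k) \<Longrightarrow>
       (\<And>x. dim_vec x = k \<Longrightarrow> \<alpha>\<^sup>\<dagger> *\<^sub>v (Y *\<^sub>v x) = 0\<^sub>v m) \<Longrightarrow>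
       (\<And>x. dim_vec x = k \<Longrightarrow> Y *\<^sub>v x = 0\<^sub>v k \<Longrightarrow> Y *\<^sub>v (A *\<^sub>v x) = 0\<^sub>v k) \<Longrightarrow> Y = 0\<^sub>m k k"
  shows "\<exists>c. \<forall>X \<in> riccati_subsolutions k F A \<alpha> Q. re_trace X \<le> c"
proof (rule ccontr)
  assume "\<not> ?thesis"
  then have "\<forall>n. \<exists>X. X \<in> riccati_subsolutions k F A \<alpha> Q \<and> real (Suc n) < re_trace X"
    by (auto simp: not_le)
  from choice[OF this] obtain X where
    XS: "\<And>n. X n \<in> riccati_subsolutions k F A \<alpha> Q" and big: "\<And>n. real (Suc n) < re_trace (X n)" by blast
  define t where "t n = re_trace (X n)" for n
  have t0: "0 < t n" for n using big[of n] by (simp add: t_def)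
  have psdX: "psd k (X n)" for n using XS[of n] by (simp add: riccati_subsolutions_def)
  define Y where "Y n = of_real (1 / t n) \<cdot>\<^sub>m X n" for n
  have psdY: "psd k (Y n)" for n
    unfolding Y_def using psd_smult[OF psdX[of n], of "1 / t n"] t0[of n] by (simp add: less_imp_le)
  have trY: "re_trace (Y n) = 1" for n
    using re_trace_smult[of "X n" k "1 / t n"] psdX[of n] t0[of n]
    by (simp add: Y_def psd_def t_def[symmetric])
  obtain r L where r: "strict_mono r" and lim: "mat_tendsto k (\<lambda>n. Y (r n)) L" and L: "psd k L"
  proof (rule psd_bounded_trace_compact[of k Y 1])
    show "psd k (Y n)" "re_trace (Y n) \<le> 1" for n using psdY trY by auto
  qed blast
  have trL: "re_trace L = 1"
    using re_trace_tendsto[OF lim] by (simp add: trY LIMSEQ_const_iff)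
  have dX: "dim_row (X n) = k" "dim_col (X n) = k" for n using psd_dim[OF psdX] by auto
  note d = psd_dim[OF L] carrier_matD[OF A] carrier_matD[OF \<alpha>] carrier_matD[OF F] psd_dim[OF Q]
  have Yx: "Y n *\<^sub>v x = of_real (1 / t n) \<cdot>\<^sub>v (X n *\<^sub>v x)" if "dim_vec x = k" for n x
    unfolding Y_def using that dX by (simp add: smult_mult_vec)
  have FY: "F *\<^sub>v (L *\<^sub>v x) = 0\<^sub>v k" if x: "dim_vec x = k" for x
  proof -
    have "F *\<^sub>v (Y n *\<^sub>v x) = 0\<^sub>v k" for n
    proof -
      have "F *\<^sub>v (X n *\<^sub>v x) = 0\<^sub>v k" using XS[of n] x by (simp add: riccati_subsolutions_def)
      then show ?thesis
        using x dX d smult_zero_vec[of "1 / complex_of_real (t n)" k] by (simp add: Yx mult_vec_smult)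
    qed
    then have "vec_tendsto k (\<lambda>n. 0\<^sub>v k) (F *\<^sub>v (L *\<^sub>v x))"
      using vec_tendsto_mult_const[OF vec_tendsto_mult[OF lim x] d(8)] d by simp
    then show ?thesis
      using vec_tendsto_unique vec_tendsto_const[of "0\<^sub>v k" k] by fastforce
  qed
  have t_inf: "(\<lambda>n. 1 / t (r n)) \<longlonglongrightarrow> 0"
  proof (rule tendsto_sandwich[OF _ _ tendsto_const LIMSEQ_Suc[OF lim_1_over_n]])
    show "\<forall>\<^sub>F n in sequentially. 0 \<le> 1 / t (r n)"
      using t0 by (simp add: less_imp_le)
    have "1 / t (r n) \<le> 1 / real (Suc n)" for n
    proof (rule divide_left_mono)
      have "n \<le> r n" by (rule seq_suble[OF r])
      then have "real (Suc n) \<le> real (Suc (r n))" by simp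
      then show "real (Suc n) \<le> t (r n)" using big[of "r n"] by (simp add: t_def)
    qed (use t0 in auto)
    then show "\<forall>\<^sub>F n in sequentially. 1 / t (r n) \<le> 1 / real (Suc n)" by simp
  qed
  define a where "a Z x = 2 * Re ((Z *\<^sub>v x) \<bullet>c (A *\<^sub>v x))" for Z x
  define b where "b Z x = sq_norm_vec (\<alpha>\<^sup>\<dagger> *\<^sub>v (Z *\<^sub>v x))" for Z x
  have key: "b (Y n) x \<le> a (Y n) x * (1 / t n) + Re ((Q *\<^sub>v x) \<bullet>c x) * (1 / t n) * (1 / t n)"
    if x: "dim_vec x = k" for n x
  proof -
    have "0 \<le> a (X n) x - b (X n) x + Re ((Q *\<^sub>v x) \<bullet>c x)"
      using XS[of n] x by (simp add: riccati_subsolutions_def riccati_form_def a_def b_def)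
    moreover have "a (Y n) x = (1 / t n) * a (X n) x"
      unfolding a_def using x dX d by (simp add: Yx cip_simps)
    moreover have "b (Y n) x = (1 / t n)\<^sup>2 * b (X n) x"
      unfolding b_def using x dX d t0[of n] by (simp add: Yx mult_vec_smult sq_norm_vec_smult norm_divide)
    ultimately show ?thesis
      using t0[of n] by (simp add: power2_eq_square field_simps)
  qed
  have lim_a: "(\<lambda>n. a (Y (r n)) x) \<longlonglongrightarrow> a L x" if x: "dim_vec x = k" for x
    unfolding a_def using x d by (intro tendsto_mult tendsto_const tendsto_Re cip_tendsto_const[OF lim]) auto
  have lim_b: "(\<lambda>n. b (Y (r n)) x) \<longlonglongrightarrow> b L x" if x: "dim_vec x = k" for x
  proof -
    have "vec_tendsto m (\<lambda>n. \<alpha>\<^sup>\<dagger> *\<^sub>v (Y (r n) *\<^sub>v x)) (\<alpha>\<^sup>\<dagger> *\<^sub>v (L *\<^sub>v x))"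
      using vec_tendsto_mult_const[OF vec_tendsto_mult[OF lim x], of "\<alpha>\<^sup>\<dagger>"] d by simp
    then show ?thesis
      unfolding b_def sq_norm_vec_def by (intro tendsto_Re cip_tendsto)
  qed
  have \<alpha>L: "\<alpha>\<^sup>\<dagger> *\<^sub>v (L *\<^sub>v x) = 0\<^sub>v m" if x: "dim_vec x = k" for x
  proof -
    have "b L x \<le> a L x * 0 + Re ((Q *\<^sub>v x) \<bullet>c x) * 0 * 0"
    proof (rule LIMSEQ_le)
      show "(\<lambda>n. a (Y (r n)) x * (1 / t (r n)) + Re ((Q *\<^sub>v x) \<bullet>c x) * (1 / t (r n)) * (1 / t (r n)))
          \<longlonglongrightarrow> a L x * 0 + Re ((Q *\<^sub>v x) \<bullet>c x) * 0 * 0"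
        by (intro tendsto_add tendsto_mult lim_a[OF x] t_inf tendsto_const)
    qed (use lim_b[OF x] key[OF x] in auto)
    then have "sq_norm_vec (\<alpha>\<^sup>\<dagger> *\<^sub>v (L *\<^sub>v x)) = 0"
      using sq_norm_vec_ge0[of "\<alpha>\<^sup>\<dagger> *\<^sub>v (L *\<^sub>v x)"] unfolding b_def by linarith
    then show ?thesis using d by (simp add: sq_norm_vec_eq0)
  qed
  have a_nonneg: "0 \<le> a L x" if x: "dim_vec x = k" for x
  proof -
    have "- Re ((Q *\<^sub>v x) \<bullet>c x) * (1 / t n) \<le> a (Y n) x" for n
    proof -
      have "0 \<le> a (Y n) x * (1 / t n) + Re ((Q *\<^sub>v x) \<bullet>c x) * (1 / t n) * (1 / t n)"
        using key[OF x, of n] sq_norm_vec_ge0[of "\<alpha>\<^sup>\<dagger> *\<^sub>v (Y n *\<^sub>v x)"] unfolding b_def by linarith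
      then have "0 \<le> (a (Y n) x + Re ((Q *\<^sub>v x) \<bullet>c x) * (1 / t n)) * (1 / t n)"
        by (simp only: distrib_right)
      then have "0 \<le> a (Y n) x + Re ((Q *\<^sub>v x) \<bullet>c x) * (1 / t n)"
        using t0[of n] by (simp only: zero_le_mult_iff) (auto simp: less_imp_le not_le)
      then show ?thesis by simp
    qed
    then have "- Re ((Q *\<^sub>v x) \<bullet>c x) * 0 \<le> a L x"
      by (intro LIMSEQ_le[OF tendsto_mult[OF tendsto_const t_inf] lim_a[OF x]]) blast
    then show ?thesis by simp
  qed
  define P where "P = L * A + A\<^sup>\<dagger> * L"
  have Px: "P *\<^sub>v x = L *\<^sub>v (A *\<^sub>v x) + A\<^sup>\<dagger> *\<^sub>v (L *\<^sub>v x)" if "dim_vec x = k" for x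
    unfolding P_def using that d by (simp add: mat_vec_simps)
  have hL: "L\<^sup>\<dagger> = L" using L by (simp add: psd_def)
  have formP: "Re ((P *\<^sub>v x) \<bullet>c x) = a L x" if x: "dim_vec x = k" for x
  proof -
    have "(L *\<^sub>v (A *\<^sub>v x)) \<bullet>c x = cnj ((L *\<^sub>v x) \<bullet>c (A *\<^sub>v x))"
      using hermitian_cip[OF hL, of "A *\<^sub>v x" x] cip_commute[of "A *\<^sub>v x" "L *\<^sub>v x"] x d by simp
    moreover have "(A\<^sup>\<dagger> *\<^sub>v (L *\<^sub>v x)) \<bullet>c x = (L *\<^sub>v x) \<bullet>c (A *\<^sub>v x)"
      using cip_adjoint[of "L *\<^sub>v x" "A\<^sup>\<dagger>" x] x d by simp
    ultimately show ?thesis using x d by (simp add: Px cip_simps a_def)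
  qed
  have psdP: "psd k P"
    unfolding psd_def
  proof (intro conjI allI impI)
    show "P \<in> carrier_mat k k" using d by (auto simp: P_def)
    have "P\<^sup>\<dagger> = A\<^sup>\<dagger> * L + L * A"
      unfolding P_def using d hL by (simp add: adjoint_add adjoint_mult)
    also have "\<dots> = P"
      unfolding P_def by (rule comm_add_mat) (use d in auto)
    finally show "P\<^sup>\<dagger> = P" .
  qed (use formP a_nonneg in auto)
  have "L = 0\<^sub>m k k"
  proof (rule reach[OF L FY \<alpha>L])
    fix x :: "complex vec" assume x: "dim_vec x = k" and Lx: "L *\<^sub>v x = 0\<^sub>v k"
    have "Re ((P *\<^sub>v x) \<bullet>c x) = 0"
      using x d by (simp add: formP a_def Lx)
    then have "P *\<^sub>v x = 0\<^sub>v k" by (rule psd_kernel[OF psdP x])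
    then have "L *\<^sub>v (A *\<^sub>v x) + 0\<^sub>v k = 0\<^sub>v k"
      using Px[OF x] Lx mult_vec_zero[of "A\<^sup>\<dagger>" k] d by simp
    then show "L *\<^sub>v (A *\<^sub>v x) = 0\<^sub>v k"
      using d right_zero_vec[of "L *\<^sub>v (A *\<^sub>v x)" k] carrier_vecI[of "L *\<^sub>v (A *\<^sub>v x)" k] by simp
  qed
  then show False using trL by (simp add: re_trace_def)
qed

lemma sq_norm_vec_add_smult:
  assumes "dim_vec g = dim_vec h"
  shows "sq_norm_vec (g + a \<cdot>\<^sub>v h) = sq_norm_vec g + 2 * Re (a * (h \<bullet>c g)) + (cmod a)\<^sup>2 * sq_norm_vec h"
proof -
  have "(g + a \<cdot>\<^sub>v h) \<bullet>c (g + a \<cdot>\<^sub>v h)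
      = g \<bullet>c g + a * (h \<bullet>c g) + cnj (a * (h \<bullet>c g)) + a * cnj a * (h \<bullet>c h)"
    using assms cip_commute[of g h] by (simp add: cip_simps algebra_simps)
  also have "\<dots> = of_real (sq_norm_vec g) + a * (h \<bullet>c g) + cnj (a * (h \<bullet>c g))
      + of_real ((cmod a)\<^sup>2) * of_real (sq_norm_vec h)"
    by (simp only: cip_self complex_norm_square)
  finally have "sq_norm_vec (g + a \<cdot>\<^sub>v h) = Re \<dots>"
    by (simp only: sq_norm_vec_def)
  then show ?thesis by simp
qed

lemma riccati_mat_mult_vec:
  assumes "A \<in> carrier_mat k k" "\<alpha> \<in> carrier_mat k m" "Q \<in> carrier_mat k k" "X \<in> carrier_mat k k" "dim_vec x = k"
  shows "riccati_mat A \<alpha> Q X *\<^sub>v x = X *\<^sub>v (A *\<^sub>v x) + A\<^sup>\<dagger> *\<^sub>v (X *\<^sub>v x)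
           - X *\<^sub>v (\<alpha> *\<^sub>v (\<alpha>\<^sup>\<dagger> *\<^sub>v (X *\<^sub>v x))) + Q *\<^sub>v x"
  unfolding riccati_mat_def using assms by (simp add: mat_vec_simps)

lemma riccati_mat_cip:
  assumes A: "A \<in> carrier_mat k k" and \<alpha>: "\<alpha> \<in> carrier_mat k m" and Q: "Q \<in> carrier_mat k k"
    and X: "X \<in> carrier_mat k k" "X\<^sup>\<dagger> = X" and x: "dim_vec x = k" and y: "dim_vec y = k"
  shows "(riccati_mat A \<alpha> Q X *\<^sub>v x) \<bullet>c y = (A *\<^sub>v x) \<bullet>c (X *\<^sub>v y) + (X *\<^sub>v x) \<bullet>c (A *\<^sub>v y)
           - (\<alpha>\<^sup>\<dagger> *\<^sub>v (X *\<^sub>v x)) \<bullet>c (\<alpha>\<^sup>\<dagger> *\<^sub>v (X *\<^sub>v y)) + (Q *\<^sub>v x) \<bullet>c y"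
proof -
  note d = carrier_matD[OF A] carrier_matD[OF \<alpha>] carrier_matD[OF Q] carrier_matD[OF X(1)] x y
  have "(X *\<^sub>v (A *\<^sub>v x)) \<bullet>c y = (A *\<^sub>v x) \<bullet>c (X *\<^sub>v y)"
    using hermitian_cip[OF X(2), of "A *\<^sub>v x" y] d by simp
  moreover have "(A\<^sup>\<dagger> *\<^sub>v (X *\<^sub>v x)) \<bullet>c y = (X *\<^sub>v x) \<bullet>c (A *\<^sub>v y)"
    using cip_adjoint[of "X *\<^sub>v x" "A\<^sup>\<dagger>" y] d by simp
  moreover have "(X *\<^sub>v (\<alpha> *\<^sub>v (\<alpha>\<^sup>\<dagger> *\<^sub>v (X *\<^sub>v x)))) \<bullet>c y
      = (\<alpha>\<^sup>\<dagger> *\<^sub>v (X *\<^sub>v x)) \<bullet>c (\<alpha>\<^sup>\<dagger> *\<^sub>v (X *\<^sub>v y))"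
    using hermitian_cip[OF X(2), of "\<alpha> *\<^sub>v (\<alpha>\<^sup>\<dagger> *\<^sub>v (X *\<^sub>v x))" y]
      cip_adjoint[of "\<alpha>\<^sup>\<dagger> *\<^sub>v (X *\<^sub>v x)" \<alpha> "X *\<^sub>v y"] d by simp
  ultimately show ?thesis
    using d by (simp add: riccati_mat_mult_vec[OF A \<alpha> Q X(1) x] cip_simps)
qed

lemma riccati_mat_hermitian:
  assumes A: "A \<in> carrier_mat k k" and \<alpha>: "\<alpha> \<in> carrier_mat k m" and Q: "Q \<in> carrier_mat k k" "Q\<^sup>\<dagger> = Q"
    and X: "X \<in> carrier_mat k k" "X\<^sup>\<dagger> = X"
  shows "(riccati_mat A \<alpha> Q X)\<^sup>\<dagger> = riccati_mat A \<alpha> Q X"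
proof -
  note d = carrier_matD[OF A] carrier_matD[OF \<alpha>] carrier_matD[OF Q(1)] carrier_matD[OF X(1)]
  have "X * (\<alpha> * (\<alpha>\<^sup>\<dagger> * X)) = X * \<alpha> * \<alpha>\<^sup>\<dagger> * X"
    using assoc_mult_mat[of X k k \<alpha> m "\<alpha>\<^sup>\<dagger> * X" k] assoc_mult_mat[of "X * \<alpha>" k m "\<alpha>\<^sup>\<dagger>" k X k]
      \<alpha> X adjoint_carrier[OF \<alpha>] by auto
  then show ?thesis
    using d X(2) Q(2) comm_add_mat[of "X * A" k k "A\<^sup>\<dagger> * X", OF carrier_matI carrier_matI]
    by (simp add: riccati_mat_def adjoint_add adjoint_diff adjoint_mult)
qed

lemma riccati_mat_form:
  assumes A: "A \<in> carrier_mat k k" and \<alpha>: "\<alpha> \<in> carrier_mat k m" and Q: "Q \<in> carrier_mat k k"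
    and X: "X \<in> carrier_mat k k" "X\<^sup>\<dagger> = X" and x: "dim_vec x = k"
  shows "Re ((riccati_mat A \<alpha> Q X *\<^sub>v x) \<bullet>c x) = riccati_form A \<alpha> Q X x"
proof -
  have "Re ((A *\<^sub>v x) \<bullet>c (X *\<^sub>v x)) = Re ((X *\<^sub>v x) \<bullet>c (A *\<^sub>v x))"
    using cip_commute[of "A *\<^sub>v x" "X *\<^sub>v x"] A X by simp
  then show ?thesis
    by (simp add: riccati_mat_cip[OF assms x] riccati_form_def sq_norm_vec_def)
qed

lemma riccati_subsolution_closed:
  assumes A: "A \<in> carrier_mat k k" and \<alpha>: "\<alpha> \<in> carrier_mat k m" and F: "F \<in> carrier_mat k k"
    and XS: "\<And>n. X n \<in> riccati_subsolutions k F A \<alpha> Q" and lim: "mat_tendsto k X L"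
  shows "L \<in> riccati_subsolutions k F A \<alpha> Q"
  unfolding riccati_subsolutions_def
proof (intro CollectI conjI allI impI)
  note d = carrier_matD[OF A] carrier_matD[OF \<alpha>] carrier_matD[OF F]
  show "psd k L" using psd_limit[OF _ lim] XS by (simp add: riccati_subsolutions_def)
  fix x :: "complex vec" assume x: "dim_vec x = k"
  have 0: "F *\<^sub>v (X n *\<^sub>v x) = 0\<^sub>v k" for n using XS[of n] x by (simp add: riccati_subsolutions_def)
  have "vec_tendsto k (\<lambda>n. F *\<^sub>v (X n *\<^sub>v x)) (F *\<^sub>v (L *\<^sub>v x))"
    using vec_tendsto_mult_const[OF vec_tendsto_mult[OF lim x], of F] d by simp
  then have "vec_tendsto k (\<lambda>n. 0\<^sub>v k) (F *\<^sub>v (L *\<^sub>v x))" by (simp only: 0)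
  then show "F *\<^sub>v (L *\<^sub>v x) = 0\<^sub>v k"
    by (rule vec_tendsto_unique) (simp add: vec_tendsto_const)
  have "vec_tendsto m (\<lambda>n. \<alpha>\<^sup>\<dagger> *\<^sub>v (X n *\<^sub>v x)) (\<alpha>\<^sup>\<dagger> *\<^sub>v (L *\<^sub>v x))"
    using vec_tendsto_mult_const[OF vec_tendsto_mult[OF lim x], of "\<alpha>\<^sup>\<dagger>"] d by simp
  then have "(\<lambda>n. riccati_form A \<alpha> Q (X n) x) \<longlonglongrightarrow> riccati_form A \<alpha> Q L x"
    unfolding riccati_form_def sq_norm_vec_def using x d
    by (intro tendsto_add tendsto_diff tendsto_mult tendsto_const tendsto_Re cip_tendsto[of m]
        cip_tendsto_const[OF lim]) auto
  then show "0 \<le> riccati_form A \<alpha> Q L x"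
    by (rule LIMSEQ_le_const) (use XS x in \<open>auto simp: riccati_subsolutions_def\<close>)
qed

text \<open>Let \<open>T \<noteq> 0\<close> be the residual, \<open>r r\<^sup>\<dagger> \<le> T\<close>, and \<open>M = (A - \<alpha> \<alpha>\<^sup>\<dagger> X)\<^sup>\<dagger>\<close> the adjoint of the
  closed-loop matrix. Choose \<open>s > 0\<close> and \<open>v\<close> with \<open>M v = s v + r\<close>. Adding \<open>\<delta> v v\<^sup>\<dagger>\<close> to \<open>X\<close> turns the
  residual into
  \<open>T + \<delta> (r v\<^sup>\<dagger> + v r\<^sup>\<dagger>) + (2 s \<delta> - \<delta>\<^sup>2 c) v v\<^sup>\<dagger>\<close> with \<open>c = |\<alpha>\<^sup>\<dagger> v|\<^sup>2\<close>, and for \<open>\<delta> (1 + c) = 2 s\<close> this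
  is \<open>T - r r\<^sup>\<dagger> + (r + \<delta> v) (r + \<delta> v)\<^sup>\<dagger>\<close>.\<close>

lemma riccati_subsolution_improve:
  assumes A: "A \<in> carrier_mat k k" and \<alpha>: "\<alpha> \<in> carrier_mat k m" and Q: "psd k Q"
    and F: "F \<in> carrier_mat k k"
    and FA: "\<And>x. dim_vec x = k \<Longrightarrow> F *\<^sub>v (A\<^sup>\<dagger> *\<^sub>v x) = 0\<^sub>v k"
    and FQ: "\<And>x. dim_vec x = k \<Longrightarrow> F *\<^sub>v (Q *\<^sub>v x) = 0\<^sub>v k"
    and XS: "X \<in> riccati_subsolutions k F A \<alpha> Q" and nz: "riccati_mat A \<alpha> Q X \<noteq> 0\<^sub>m k k"
  shows "\<exists>X' \<in> riccati_subsolutions k F A \<alpha> Q. re_trace X < re_trace X'"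
proof -
  define T where "T = riccati_mat A \<alpha> Q X"
  have psdX: "psd k X" and FX: "\<And>x. dim_vec x = k \<Longrightarrow> F *\<^sub>v (X *\<^sub>v x) = 0\<^sub>v k"
    and form: "\<And>x. dim_vec x = k \<Longrightarrow> 0 \<le> riccati_form A \<alpha> Q X x"
    using XS by (auto simp: riccati_subsolutions_def)
  have X: "X \<in> carrier_mat k k" "X\<^sup>\<dagger> = X" and Qc: "Q \<in> carrier_mat k k" "Q\<^sup>\<dagger> = Q"
    using psdX Q by (auto simp: psd_def)
  note d = carrier_matD[OF A] carrier_matD[OF \<alpha>] carrier_matD[OF Qc(1)] carrier_matD[OF X(1)]
    carrier_matD[OF F]
  have psdT: "psd k T"
    unfolding psd_def T_def
    using riccati_mat_hermitian[OF A \<alpha> Qc X] riccati_mat_form[OF A \<alpha> Qc(1) X] form d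
    by (auto simp: riccati_mat_def intro!: carrier_matI)
  obtain y where y: "dim_vec y = k" "T *\<^sub>v y \<noteq> 0\<^sub>v k"
    and dom: "\<And>x. dim_vec x = k \<Longrightarrow> (cmod (x \<bullet>c (T *\<^sub>v y)))\<^sup>2 \<le> Re ((T *\<^sub>v x) \<bullet>c x)"
    using psd_dominates_rank_one[OF psdT] nz by (auto simp: T_def)
  define r where "r = T *\<^sub>v y"
  have r: "dim_vec r = k" using psd_dim[OF psdT] by (simp add: r_def)
  have Fr: "F *\<^sub>v r = 0\<^sub>v k"
    unfolding r_def T_def riccati_mat_mult_vec[OF A \<alpha> Qc(1) X(1) y(1)]
    using FX FA FQ y d by (simp add: mult_vec_add mult_vec_diff)
  define M where "M = A\<^sup>\<dagger> - X * (\<alpha> * \<alpha>\<^sup>\<dagger>)"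
  have Mv: "M *\<^sub>v v = A\<^sup>\<dagger> *\<^sub>v v - X *\<^sub>v (\<alpha> *\<^sub>v (\<alpha>\<^sup>\<dagger> *\<^sub>v v))" if "dim_vec v = k" for v
    unfolding M_def using that d by (simp add: mat_vec_simps)
  have "M \<in> carrier_mat k k" using d by (auto simp: M_def)
  then obtain s :: real where s: "0 < s" and "\<exists>v. dim_vec v = k \<and> M *\<^sub>v v = of_real s \<cdot>\<^sub>v v + r"
    using shifted_solve r by metis
  then obtain v where v: "dim_vec v = k" and eq: "M *\<^sub>v v = of_real s \<cdot>\<^sub>v v + r" by blast
  have vnz: "v \<noteq> 0\<^sub>v k"
  proof
    assume v0: "v = 0\<^sub>v k"
    have "M *\<^sub>v v = 0\<^sub>v k"
      using mult_vec_zero[of M k] \<open>M \<in> carrier_mat k k\<close> v0 by simp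
    then have "r = 0\<^sub>v k" using eq left_zero_vec[OF carrier_vecI[OF r]] v0 by simp
    then show False using y(2) by (simp add: r_def)
  qed
  \<comment> \<open>\<open>F\<close> annihilates both \<open>r\<close> and the range of \<open>M\<close>, so \<open>s F v = 0\<close>.\<close>
  have Fv: "F *\<^sub>v v = 0\<^sub>v k"
  proof -
    have "F *\<^sub>v (M *\<^sub>v v) = 0\<^sub>v k"
      using v d FA FX by (simp add: Mv mult_vec_diff)
    then have "of_real s \<cdot>\<^sub>v (F *\<^sub>v v) = 0\<^sub>v k"
      using v r d Fr carrier_vecI[of "F *\<^sub>v v" k] by (simp add: eq mult_vec_add mult_vec_smult)
    then have "of_real s * (F *\<^sub>v v) $ i = 0" if "i < k" for i
      using that d by (metis index_smult_vec(1) dim_mult_mat_vec index_zero_vec(1))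
    then show ?thesis using s d by (intro eq_vecI) auto
  qed
  define c where "c = sq_norm_vec (\<alpha>\<^sup>\<dagger> *\<^sub>v v)"
  have c: "0 \<le> c" by (simp add: c_def)
  define \<delta> where "\<delta> = 2 * s / (1 + c)"
  have \<delta>: "0 < \<delta>" using s c by (simp add: \<delta>_def)
  have \<delta>c: "\<delta> + \<delta> * c = 2 * s" proof -
    have "\<delta> * (1 + c) = 2 * s" using c by (simp add: \<delta>_def)
    then show ?thesis by (simp only: distrib_left mult_1_right)
  qed
  define X' where "X' = X + of_real \<delta> \<cdot>\<^sub>m outer v"
  have oc: "outer v \<in> carrier_mat k k" using outer_carrier[OF v] .
  have X'x: "X' *\<^sub>v x = X *\<^sub>v x + (of_real \<delta> * (x \<bullet>c v)) \<cdot>\<^sub>v v" if x: "dim_vec x = k" for x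
    unfolding X'_def using x v d oc
    by (simp add: add_mult_vec smult_mult_vec outer_mult_vec smult_smult_assoc)
  have "psd k X'"
    unfolding X'_def using psd_add_outer[OF psdX v] \<delta> by simp
  moreover have "F *\<^sub>v (X' *\<^sub>v x) = 0\<^sub>v k" if x: "dim_vec x = k" for x
    using x v d FX[OF x] Fv smult_zero_vec[of "of_real \<delta> * (x \<bullet>c v)" k]
    by (simp add: X'x mult_vec_add mult_vec_smult)
  moreover have "0 \<le> riccati_form A \<alpha> Q X' x" if x: "dim_vec x = k" for x
  proof -
    define p where "p = x \<bullet>c v"
    define \<rho> where "\<rho> = x \<bullet>c r"
    have ray: "v \<bullet>c (A *\<^sub>v x) - (\<alpha>\<^sup>\<dagger> *\<^sub>v v) \<bullet>c (\<alpha>\<^sup>\<dagger> *\<^sub>v (X *\<^sub>v x)) = of_real s * cnj p + cnj \<rho>"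
    proof -
      have "(M *\<^sub>v v) \<bullet>c x = v \<bullet>c (A *\<^sub>v x) - (\<alpha>\<^sup>\<dagger> *\<^sub>v v) \<bullet>c (\<alpha>\<^sup>\<dagger> *\<^sub>v (X *\<^sub>v x))"
        using cip_adjoint[of v "A\<^sup>\<dagger>" x] hermitian_cip[OF X(2), of "\<alpha> *\<^sub>v (\<alpha>\<^sup>\<dagger> *\<^sub>v v)" x]
          cip_adjoint[of "\<alpha>\<^sup>\<dagger> *\<^sub>v v" \<alpha> "X *\<^sub>v x"] v x d by (simp add: Mv cip_simps)
      moreover have "(M *\<^sub>v v) \<bullet>c x = of_real s * cnj p + cnj \<rho>"
        using v x r cip_commute[of v x] cip_commute[of r x] by (simp add: eq cip_simps p_def \<rho>_def)
      ultimately show ?thesis by simp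
    qed
    have e1: "(X' *\<^sub>v x) \<bullet>c (A *\<^sub>v x) = (X *\<^sub>v x) \<bullet>c (A *\<^sub>v x) + of_real \<delta> * p * (v \<bullet>c (A *\<^sub>v x))"
      using x v d by (simp add: X'x cip_simps p_def)
    have e2: "sq_norm_vec (\<alpha>\<^sup>\<dagger> *\<^sub>v (X' *\<^sub>v x)) = sq_norm_vec (\<alpha>\<^sup>\<dagger> *\<^sub>v (X *\<^sub>v x))
        + 2 * \<delta> * Re (p * ((\<alpha>\<^sup>\<dagger> *\<^sub>v v) \<bullet>c (\<alpha>\<^sup>\<dagger> *\<^sub>v (X *\<^sub>v x)))) + \<delta>\<^sup>2 * (cmod p)\<^sup>2 * c"
    proof -
      define g where "g = \<alpha>\<^sup>\<dagger> *\<^sub>v (X *\<^sub>v x)"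
      define h where "h = \<alpha>\<^sup>\<dagger> *\<^sub>v v"
      have gh: "dim_vec g = m" "dim_vec h = m" using d by (auto simp: g_def h_def)
      have "\<alpha>\<^sup>\<dagger> *\<^sub>v (X' *\<^sub>v x) = g + (of_real \<delta> * p) \<cdot>\<^sub>v h"
        using x v d by (simp add: X'x mult_vec_add mult_vec_smult g_def h_def p_def)
      moreover have "sq_norm_vec (g + (of_real \<delta> * p) \<cdot>\<^sub>v h) = sq_norm_vec g
          + 2 * \<delta> * Re (p * (h \<bullet>c g)) + \<delta>\<^sup>2 * (cmod p)\<^sup>2 * sq_norm_vec h"
        using sq_norm_vec_add_smult[of g h "of_real \<delta> * p"] gh
        by (simp add: norm_mult power_mult_distrib mult.assoc)
      ultimately show ?thesis by (simp add: c_def g_def h_def)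
    qed
    have lower: "(cmod \<rho>)\<^sup>2 \<le> riccati_form A \<alpha> Q X x"
      using dom[OF x] riccati_mat_form[OF A \<alpha> Qc(1) X x] by (simp add: \<rho>_def r_def T_def)
    have "riccati_form A \<alpha> Q X' x = riccati_form A \<alpha> Q X x
        + 2 * \<delta> * Re (p * (v \<bullet>c (A *\<^sub>v x) - (\<alpha>\<^sup>\<dagger> *\<^sub>v v) \<bullet>c (\<alpha>\<^sup>\<dagger> *\<^sub>v (X *\<^sub>v x)))) - \<delta>\<^sup>2 * (cmod p)\<^sup>2 * c"
      unfolding riccati_form_def e1 e2 by (simp add: algebra_simps)
    also have "\<dots> = riccati_form A \<alpha> Q X x + 2 * \<delta> * s * (cmod p)\<^sup>2 + 2 * \<delta> * Re (p * cnj \<rho>)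
        - \<delta>\<^sup>2 * (cmod p)\<^sup>2 * c"
      unfolding ray cmod_power2 by (simp add: power2_eq_square algebra_simps)
    also have "\<dots> = riccati_form A \<alpha> Q X x - (cmod \<rho>)\<^sup>2 + (cmod (\<rho> + of_real \<delta> * p))\<^sup>2"
    proof -
      have "2 * \<delta> * s * (cmod p)\<^sup>2 = \<delta> * (\<delta> + \<delta> * c) * (cmod p)\<^sup>2"
        unfolding \<delta>c by simp
      moreover have "(cmod (\<rho> + of_real \<delta> * p))\<^sup>2 = (cmod \<rho>)\<^sup>2 + 2 * \<delta> * Re (p * cnj \<rho>) + \<delta>\<^sup>2 * (cmod p)\<^sup>2"
        unfolding cmod_power2 by (simp add: power2_eq_square algebra_simps)
      ultimately show ?thesis by (simp add: power2_eq_square algebra_simps)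
    qed
    finally show ?thesis using lower by (metis add_nonneg_nonneg diff_ge_0_iff_ge zero_le_power2)
  qed
  ultimately have "X' \<in> riccati_subsolutions k F A \<alpha> Q" by (simp add: riccati_subsolutions_def)
  moreover have "re_trace X < re_trace X'"
  proof -
    have "0 < sq_norm_vec v"
      using vnz v sq_norm_vec_eq0[of v] sq_norm_vec_ge0[of v] by (simp add: less_le)
    then show ?thesis
      using re_trace_add_smult[OF X(1) oc, of \<delta>] \<delta> by (simp add: X'_def re_trace_outer)
  qed
  ultimately show ?thesis by blast
qed

lemma riccati_solution_exists:
  assumes A: "A \<in> carrier_mat k k" and \<alpha>: "\<alpha> \<in> carrier_mat k m" and Q: "psd k Q"
    and F: "F \<in> carrier_mat k k"
    and FA: "\<And>x. dim_vec x = k \<Longrightarrow> F *\<^sub>v (A\<^sup>\<dagger> *\<^sub>v x) = 0\<^sub>v k"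
    and FQ: "\<And>x. dim_vec x = k \<Longrightarrow> F *\<^sub>v (Q *\<^sub>v x) = 0\<^sub>v k"
    and reach: "\<And>Y. psd k Y \<Longrightarrow> (\<And>x. dim_vec x = k \<Longrightarrow> F *\<^sub>v (Y *\<^sub>v x) = 0\<^sub>v k) \<Longrightarrow>
       (\<And>x. dim_vec x = k \<Longrightarrow> \<alpha>\<^sup>\<dagger> *\<^sub>v (Y *\<^sub>v x) = 0\<^sub>v m) \<Longrightarrow>
       (\<And>x. dim_vec x = k \<Longrightarrow> Y *\<^sub>v x = 0\<^sub>v k \<Longrightarrow> Y *\<^sub>v (A *\<^sub>v x) = 0\<^sub>v k) \<Longrightarrow> Y = 0\<^sub>m k k"
  shows "\<exists>X. psd k X \<and> (\<forall>x. dim_vec x = k \<longrightarrow> F *\<^sub>v (X *\<^sub>v x) = 0\<^sub>v k) \<and>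
    riccati_mat A \<alpha> Q X = 0\<^sub>m k k"
proof -
  let ?S = "riccati_subsolutions k F A \<alpha> Q"
  obtain c where c: "\<And>X. X \<in> ?S \<Longrightarrow> re_trace X \<le> c"
    using riccati_subsolution_bounded[OF A \<alpha> Q F reach] by blast
  have z: "0\<^sub>m k k *\<^sub>v x = 0\<^sub>v k" if "dim_vec x = k" for x :: "complex vec"
    using that by (intro eq_vecI) (auto simp: scalar_prod_def)
  have "(0\<^sub>m k k :: complex mat)\<^sup>\<dagger> = 0\<^sub>m k k" by (intro eq_matI) auto
  then have "psd k (0\<^sub>m k k)" by (simp add: psd_def z)
  moreover have "0 \<le> riccati_form A \<alpha> Q (0\<^sub>m k k) x" if x: "dim_vec x = k" for x
    using Q x A \<alpha> mult_vec_zero[of "\<alpha>\<^sup>\<dagger>" k] by (simp add: riccati_form_def z psd_def sq_norm_vec_sum)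
  ultimately have ne: "0\<^sub>m k k \<in> ?S"
    using F mult_vec_zero[of F k] by (simp add: riccati_subsolutions_def z)
  obtain X where X: "X \<in> ?S" and max: "\<And>Y. Y \<in> ?S \<Longrightarrow> re_trace Y \<le> re_trace X"
  proof (rule max_trace_attained[OF ne, of k c])
    show "psd k X \<and> re_trace X \<le> c" if "X \<in> ?S" for X
      using that c by (simp add: riccati_subsolutions_def)
    show "L \<in> ?S" if "\<And>n. X n \<in> ?S" "mat_tendsto k X L" for X L
      using riccati_subsolution_closed[OF A \<alpha> F that] .
  qed blast
  have "riccati_mat A \<alpha> Q X = 0\<^sub>m k k"
    using riccati_subsolution_improve[OF A \<alpha> Q F FA FQ X] max by (meson not_le)
  then show ?thesis using X by (auto simp: riccati_subsolutions_def)
qed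

section \<open>The projection onto unreachable directions\<close>

abbreviation reach_vec :: "complex mat \<Rightarrow> complex mat \<Rightarrow> nat \<Rightarrow> complex vec \<Rightarrow> complex vec" where
  "reach_vec A \<alpha> j u \<equiv> ((\<lambda>x. A *\<^sub>v x) ^^ j) (\<alpha> *\<^sub>v u)"

lemma reach_vec_dim:
  assumes "A \<in> carrier_mat k k" "\<alpha> \<in> carrier_mat k m"
  shows "dim_vec (reach_vec A \<alpha> j u) = k"
  using assms by (cases j) auto

text \<open>Idempotence is expressed by a sesquilinear identity, because this form of it passes to entrywise
  limits directly.\<close>

definition unreachable_projections :: "nat \<Rightarrow> nat \<Rightarrow> complex mat \<Rightarrow> complex mat \<Rightarrow> complex mat set" where
  "unreachable_projections k m A \<alpha> = {F. F \<in> carrier_mat k k \<and> F\<^sup>\<dagger> = F \<and>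
     (\<forall>x y. dim_vec x = k \<longrightarrow> dim_vec y = k \<longrightarrow> (F *\<^sub>v x) \<bullet>c (F *\<^sub>v y) = (F *\<^sub>v x) \<bullet>c y) \<and>
     (\<forall>j u. dim_vec u = m \<longrightarrow> F *\<^sub>v reach_vec A \<alpha> j u = 0\<^sub>v k)}"

lemma unreachable_projections_psd:
  assumes F: "F \<in> unreachable_projections k m A \<alpha>"
  shows "psd k F" "re_trace F \<le> real k"
proof -
  have c: "F \<in> carrier_mat k k" and h: "F\<^sup>\<dagger> = F"
    and idem: "\<And>x y. dim_vec x = k \<Longrightarrow> dim_vec y = k \<Longrightarrow> (F *\<^sub>v x) \<bullet>c (F *\<^sub>v y) = (F *\<^sub>v x) \<bullet>c y"
    using F by (auto simp: unreachable_projections_def)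
  have sq: "(F *\<^sub>v x) \<bullet>c x = of_real (sq_norm_vec (F *\<^sub>v x))" if "dim_vec x = k" for x
    using idem[OF that that] cip_self[of "F *\<^sub>v x"] by simp
  show "psd k F" using c h by (simp add: psd_def sq)
  have "Re (F $$ (i, i)) \<le> 1" if i: "i < k" for i
  proof -
    let ?e = "unit_vec k i :: complex vec"
    have "0 \<le> sq_norm_vec (?e - F *\<^sub>v ?e)" by simp
    also have "(?e - F *\<^sub>v ?e) \<bullet>c (?e - F *\<^sub>v ?e) = ?e \<bullet>c ?e - (F *\<^sub>v ?e) \<bullet>c ?e"
      using c cip_commute[of ?e "F *\<^sub>v ?e"] by (simp add: cip_simps idem) (simp add: sq)
    then have "sq_norm_vec (?e - F *\<^sub>v ?e) = Re (?e \<bullet>c ?e) - Re (F $$ (i, i))"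
      using cip_unit_vec[OF c i i] by (simp add: sq_norm_vec_def)
    also have "?e \<bullet>c ?e = 1"
      using cip_unit_vec[OF one_carrier_mat i i] i by (simp add: one_mult_vec)
    finally show ?thesis by simp
  qed
  then have "re_trace F \<le> (\<Sum>i<k. 1)"
    unfolding re_trace_def carrier_matD(1)[OF c] by (intro sum_mono) auto
  then show "re_trace F \<le> real k" by simp
qed

lemma unreachable_projections_closed:
  assumes A: "A \<in> carrier_mat k k" and \<alpha>: "\<alpha> \<in> carrier_mat k m"
    and XS: "\<And>n. X n \<in> unreachable_projections k m A \<alpha>" and lim: "mat_tendsto k X L"
  shows "L \<in> unreachable_projections k m A \<alpha>"
  unfolding unreachable_projections_def
proof (intro CollectI conjI allI impI)
  have "psd k L" using psd_limit[OF unreachable_projections_psd(1)[OF XS] lim] .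
  then show "L \<in> carrier_mat k k" "L\<^sup>\<dagger> = L" by (auto simp: psd_def)
  show "(L *\<^sub>v x) \<bullet>c (L *\<^sub>v y) = (L *\<^sub>v x) \<bullet>c y" if xy: "dim_vec x = k" "dim_vec y = k" for x y
  proof (rule LIMSEQ_unique)
    show "(\<lambda>n. (X n *\<^sub>v x) \<bullet>c (X n *\<^sub>v y)) \<longlonglongrightarrow> (L *\<^sub>v x) \<bullet>c (L *\<^sub>v y)"
      by (rule cip_tendsto[OF vec_tendsto_mult[OF lim xy(1)] vec_tendsto_mult[OF lim xy(2)]])
    have "(X n *\<^sub>v x) \<bullet>c (X n *\<^sub>v y) = (X n *\<^sub>v x) \<bullet>c y" for n
      using XS[of n] xy by (simp add: unreachable_projections_def)
    then show "(\<lambda>n. (X n *\<^sub>v x) \<bullet>c (X n *\<^sub>v y)) \<longlonglongrightarrow> (L *\<^sub>v x) \<bullet>c y"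
      using cip_tendsto_const[OF lim xy] by simp
  qed
  fix j and u :: "complex vec" assume u: "dim_vec u = m"
  have "X n *\<^sub>v reach_vec A \<alpha> j u = 0\<^sub>v k" for n
    using XS[of n] u by (simp add: unreachable_projections_def)
  then have "vec_tendsto k (\<lambda>n. 0\<^sub>v k) (L *\<^sub>v reach_vec A \<alpha> j u)"
    using vec_tendsto_mult[OF lim reach_vec_dim[OF A \<alpha>], of j u] by simp
  then show "L *\<^sub>v reach_vec A \<alpha> j u = 0\<^sub>v k"
    by (rule vec_tendsto_unique) (simp add: vec_tendsto_const)
qed

lemma diff_zero_vec_eq:
  fixes v w :: "complex vec"
  assumes "v - w = 0\<^sub>v k" "dim_vec v = k" "dim_vec w = k"
  shows "v = w"
proof (rule eq_vecI)
  fix i assume i: "i < dim_vec w"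
  then have "(v - w) $ i = 0" using assms(1,3) by (simp del: index_minus_vec)
  then show "v $ i = w $ i" using i by simp
qed (use assms in simp)

text \<open>A projection of largest trace fixes every \<open>w\<close> orthogonal to the reachable space: otherwise
  \<open>v = w - F w\<close> is nonzero, orthogonal to the reachable space and annihilated by \<open>F\<close>, and
  \<open>F + v v\<^sup>\<dagger> / |v|\<^sup>2\<close> is a larger projection.\<close>

lemma unreachable_projection_exists:
  assumes A: "A \<in> carrier_mat k k" and \<alpha>: "\<alpha> \<in> carrier_mat k m"
  obtains F where "F \<in> carrier_mat k k" "F\<^sup>\<dagger> = F"
    "\<And>x. dim_vec x = k \<Longrightarrow> F *\<^sub>v (F *\<^sub>v x) = F *\<^sub>v x"
    "\<And>j u. dim_vec u = m \<Longrightarrow> F *\<^sub>v reach_vec A \<alpha> j u = 0\<^sub>v k"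
    "\<And>w. dim_vec w = k \<Longrightarrow> (\<And>j u. dim_vec u = m \<Longrightarrow> reach_vec A \<alpha> j u \<bullet>c w = 0) \<Longrightarrow> F *\<^sub>v w = w"
proof -
  let ?S = "unreachable_projections k m A \<alpha>"
  note rd = reach_vec_dim[OF A \<alpha>]
  have z: "0\<^sub>m k k *\<^sub>v x = 0\<^sub>v k" if "dim_vec x = k" for x :: "complex vec"
    using that by (intro eq_vecI) (auto simp: scalar_prod_def)
  have "(0\<^sub>m k k :: complex mat)\<^sup>\<dagger> = 0\<^sub>m k k" by (intro eq_matI) auto
  then have ne: "0\<^sub>m k k \<in> ?S"
    by (simp add: unreachable_projections_def z rd)
  obtain F where FS: "F \<in> ?S" and max: "\<And>Y. Y \<in> ?S \<Longrightarrow> re_trace Y \<le> re_trace F"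
  proof (rule max_trace_attained[OF ne, of k "real k"])
    show "psd k X \<and> re_trace X \<le> real k" if "X \<in> ?S" for X
      using unreachable_projections_psd[OF that] by simp
    show "L \<in> ?S" if "\<And>n. X n \<in> ?S" "mat_tendsto k X L" for X L
      using unreachable_projections_closed[OF A \<alpha> that] .
  qed blast
  have c: "F \<in> carrier_mat k k" and h: "F\<^sup>\<dagger> = F"
    and idem: "\<And>x y. dim_vec x = k \<Longrightarrow> dim_vec y = k \<Longrightarrow> (F *\<^sub>v x) \<bullet>c (F *\<^sub>v y) = (F *\<^sub>v x) \<bullet>c y"
    and FR: "\<And>j u. dim_vec u = m \<Longrightarrow> F *\<^sub>v reach_vec A \<alpha> j u = 0\<^sub>v k"
    using FS by (auto simp: unreachable_projections_def)
  have d: "dim_row F = k" "dim_col F = k" using c by auto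
  have FF: "F *\<^sub>v (F *\<^sub>v x) = F *\<^sub>v x" if x: "dim_vec x = k" for x
  proof (rule diff_zero_vec_eq)
    have "(F *\<^sub>v (F *\<^sub>v x) - F *\<^sub>v x) \<bullet>c y = 0" if "dim_vec y = k" for y
      using x that d hermitian_cip[OF h, of "F *\<^sub>v x" y] idem[OF x that] by (simp add: cip_simps)
    then show "F *\<^sub>v (F *\<^sub>v x) - F *\<^sub>v x = 0\<^sub>v k"
      using eq_zero_if_cip_zero[of "F *\<^sub>v (F *\<^sub>v x) - F *\<^sub>v x"] d by simp
  qed (use d in auto)
  have fixed: "F *\<^sub>v w = w"
    if w: "dim_vec w = k" and orth: "\<And>j u. dim_vec u = m \<Longrightarrow> reach_vec A \<alpha> j u \<bullet>c w = 0" for w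
  proof (rule ccontr)
    assume ne: "F *\<^sub>v w \<noteq> w"
    define v where "v = w - F *\<^sub>v w"
    have v: "dim_vec v = k" using d by (simp add: v_def)
    have Fv: "F *\<^sub>v v = 0\<^sub>v k"
      using w d minus_cancel_vec[OF carrier_vecI[of "F *\<^sub>v w" k]] by (simp add: v_def mult_vec_diff FF)
    have Rv: "reach_vec A \<alpha> j u \<bullet>c v = 0" if "dim_vec u = m" for j u
      using w d orth[OF that] FR[OF that] hermitian_cip[OF h, of "reach_vec A \<alpha> j u" w]
      by (simp add: v_def cip_simps rd)
    have "v \<noteq> 0\<^sub>v k" using ne diff_zero_vec_eq[of w "F *\<^sub>v w" k] w d by (auto simp: v_def)
    then have pos: "0 < sq_norm_vec v"
      using v sq_norm_vec_eq0[of v] sq_norm_vec_ge0[of v] by (simp add: less_le)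
    define \<gamma> where "\<gamma> = 1 / sq_norm_vec v"
    have \<gamma>: "0 < \<gamma>" "\<gamma> * sq_norm_vec v = 1" using pos by (auto simp: \<gamma>_def)
    define F' where "F' = F + of_real \<gamma> \<cdot>\<^sub>m outer v"
    have oc: "outer v \<in> carrier_mat k k" using outer_carrier[OF v] .
    have F'x: "F' *\<^sub>v x = F *\<^sub>v x + (of_real \<gamma> * (x \<bullet>c v)) \<cdot>\<^sub>v v" if x: "dim_vec x = k" for x
      unfolding F'_def using x v d oc
      by (simp add: add_mult_vec smult_mult_vec outer_mult_vec smult_smult_assoc)
    have psdF': "psd k F'"
      unfolding F'_def using psd_add_outer[OF unreachable_projections_psd(1)[OF FS] v] \<gamma> by simp
    have "F' \<in> ?S"
      unfolding unreachable_projections_def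
    proof (intro CollectI conjI allI impI)
      show "F' \<in> carrier_mat k k" "F'\<^sup>\<dagger> = F'" using psdF' by (auto simp: psd_def)
      show "F' *\<^sub>v reach_vec A \<alpha> j u = 0\<^sub>v k" if "dim_vec u = m" for j u
        using FR[OF that] Rv[OF that] v rd by (simp add: F'x) (intro eq_vecI, auto)
      fix x y :: "complex vec" assume x: "dim_vec x = k" and y: "dim_vec y = k"
      define p where "p = x \<bullet>c v"
      define q where "q = y \<bullet>c v"
      have vy: "v \<bullet>c y = cnj q" using cip_commute[of v y] v y by (simp add: q_def)
      have Fxv: "(F *\<^sub>v x) \<bullet>c v = 0"
        using hermitian_cip[OF h, of x v] x v d Fv by simp
      have vFy: "v \<bullet>c (F *\<^sub>v y) = 0"
        using hermitian_cip[OF h, of v y] y v d Fv by simp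
      have "(F' *\<^sub>v x) \<bullet>c (F' *\<^sub>v y)
          = (F *\<^sub>v x) \<bullet>c y + of_real \<gamma> * p * (of_real \<gamma> * cnj q * of_real (sq_norm_vec v))"
        using x y v d by (simp add: F'x cip_simps idem Fxv vFy cip_self[of v] p_def q_def)
      also have "of_real \<gamma> * cnj q * of_real (sq_norm_vec v) = of_real (\<gamma> * sq_norm_vec v) * cnj q"
        by simp
      also have "\<dots> = v \<bullet>c y" by (simp add: \<gamma>(2) vy)
      also have "(F *\<^sub>v x) \<bullet>c y + of_real \<gamma> * p * (v \<bullet>c y) = (F' *\<^sub>v x) \<bullet>c y"
        using x y v d by (simp add: F'x cip_simps p_def)
      finally show "(F' *\<^sub>v x) \<bullet>c (F' *\<^sub>v y) = (F' *\<^sub>v x) \<bullet>c y" .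
    qed
    then have "re_trace F' \<le> re_trace F" by (rule max)
    then show False
      using re_trace_add_smult[OF c oc, of \<gamma>] \<gamma>(2) by (simp add: F'_def re_trace_outer)
  qed
  show ?thesis by (rule that[OF c h FF FR fixed])
qed

section \<open>The feedback and its energy balance\<close>

text \<open>The reachable space is invariant under \<open>A\<close>, so its orthogonal complement is invariant under
  \<open>A\<^sup>\<dagger>\<close>; this is \<open>F A (I - F) = 0\<close>. A positive semidefinite \<open>Y\<close> whose kernel is invariant and
  contains the range of \<open>\<alpha>\<close> annihilates the reachable space, so its range is fixed by \<open>F\<close>, and
  \<open>F Y = 0\<close> leaves only \<open>Y = 0\<close>. Hence the trace bound for the Riccati inequality applies.\<close>

lemma unreachable_projection_riccati:
  assumes A: "A \<in> carrier_mat k k" and \<alpha>: "\<alpha> \<in> carrier_mat k m" and G: "G \<in> carrier_mat q k"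
  obtains F X where "F \<in> carrier_mat k k"
    "\<And>u. dim_vec u = m \<Longrightarrow> F *\<^sub>v (\<alpha> *\<^sub>v u) = 0\<^sub>v k"
    "\<And>x. dim_vec x = k \<Longrightarrow> F *\<^sub>v ((A - A * F) *\<^sub>v x) = 0\<^sub>v k"
    "psd k X" "\<And>x. dim_vec x = k \<Longrightarrow> F *\<^sub>v (X *\<^sub>v x) = 0\<^sub>v k"
    "riccati_mat (A - A * F) \<alpha> ((G - G * F)\<^sup>\<dagger> * (G - G * F)) X = 0\<^sub>m k k"
proof -
  obtain F where F: "F \<in> carrier_mat k k" and h: "F\<^sup>\<dagger> = F"
    and FF: "\<And>x. dim_vec x = k \<Longrightarrow> F *\<^sub>v (F *\<^sub>v x) = F *\<^sub>v x"
    and FR: "\<And>j u. dim_vec u = m \<Longrightarrow> F *\<^sub>v reach_vec A \<alpha> j u = 0\<^sub>v k"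
    and fix_F: "\<And>w. dim_vec w = k \<Longrightarrow> (\<And>j u. dim_vec u = m \<Longrightarrow> reach_vec A \<alpha> j u \<bullet>c w = 0) \<Longrightarrow> F *\<^sub>v w = w"
    using unreachable_projection_exists[OF A \<alpha>] by metis
  note rd = reach_vec_dim[OF A \<alpha>]
  note d = carrier_matD[OF A] carrier_matD[OF \<alpha>] carrier_matD[OF G] carrier_matD[OF F]
  define A1 where "A1 = A - A * F"
  define G1 where "G1 = G - G * F"
  define Q where "Q = G1\<^sup>\<dagger> * G1"
  have A1: "A1 \<in> carrier_mat k k" and G1: "G1 \<in> carrier_mat q k"
    using d by (auto simp: A1_def G1_def)
  have Q: "Q \<in> carrier_mat k k" using G1 by (auto simp: Q_def)
  note d1 = d carrier_matD[OF A1] carrier_matD[OF G1] carrier_matD[OF Q]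
  have A1x: "A1 *\<^sub>v x = A *\<^sub>v (x - F *\<^sub>v x)" if "dim_vec x = k" for x
    unfolding A1_def using that d by (simp add: diff_mult_vec mult_mult_vec mult_vec_diff)
  have G1x: "G1 *\<^sub>v x = G *\<^sub>v (x - F *\<^sub>v x)" if "dim_vec x = k" for x
    unfolding G1_def using that d by (simp add: diff_mult_vec mult_mult_vec mult_vec_diff)
  have Qx: "Q *\<^sub>v x = G1\<^sup>\<dagger> *\<^sub>v (G1 *\<^sub>v x)" if "dim_vec x = k" for x
    unfolding Q_def using that d1 by (simp add: mult_mult_vec)
  have zero: "v = 0\<^sub>v k" if "dim_vec v = k" "\<And>y. dim_vec y = k \<Longrightarrow> v \<bullet>c y = 0" for v :: "complex vec"
    using eq_zero_if_cip_zero[of v] that by simp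
  have kill: "x - F *\<^sub>v x = 0\<^sub>v k" if "F *\<^sub>v x = x" "dim_vec x = k" for x
    using that minus_cancel_vec[OF carrier_vecI[of x k]] by simp
  have sym: "(F *\<^sub>v x) \<bullet>c y = x \<bullet>c (F *\<^sub>v y)" if "dim_vec x = k" "dim_vec y = k" for x y
    using hermitian_cip[OF h, of x y] that d by simp
  have A1F: "A1 *\<^sub>v (F *\<^sub>v y) = 0\<^sub>v k" and G1F: "G1 *\<^sub>v (F *\<^sub>v y) = 0\<^sub>v q" if "dim_vec y = k" for y
    using that d kill[OF FF] by (simp_all add: A1x G1x mult_vec_zero)
  have AdjF: "F *\<^sub>v (A\<^sup>\<dagger> *\<^sub>v (F *\<^sub>v y)) = A\<^sup>\<dagger> *\<^sub>v (F *\<^sub>v y)" if y: "dim_vec y = k" for y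
  proof (rule fix_F)
    show "reach_vec A \<alpha> j u \<bullet>c (A\<^sup>\<dagger> *\<^sub>v (F *\<^sub>v y)) = 0" if u: "dim_vec u = m" for j u
    proof -
      have "reach_vec A \<alpha> j u \<bullet>c (A\<^sup>\<dagger> *\<^sub>v (F *\<^sub>v y)) = reach_vec A \<alpha> (Suc j) u \<bullet>c (F *\<^sub>v y)"
        using cip_adjoint[of "reach_vec A \<alpha> j u" A "F *\<^sub>v y"] d rd by simp
      also have "\<dots> = (F *\<^sub>v reach_vec A \<alpha> (Suc j) u) \<bullet>c y"
        using sym[OF rd[of "Suc j" u] y] by simp
      also have "\<dots> = 0" using FR[OF u, of "Suc j"] y by simp
      finally show ?thesis .
    qed
  qed (use d in simp)
  have FA1: "F *\<^sub>v (A1 *\<^sub>v x) = 0\<^sub>v k" if x: "dim_vec x = k" for x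
  proof (rule zero)
    fix y :: "complex vec" assume y: "dim_vec y = k"
    have "(F *\<^sub>v (A1 *\<^sub>v x)) \<bullet>c y = (A *\<^sub>v (x - F *\<^sub>v x)) \<bullet>c (F *\<^sub>v y)"
      using sym[of "A1 *\<^sub>v x" y] x y d1 by (simp add: A1x)
    also have "\<dots> = (x - F *\<^sub>v x) \<bullet>c (A\<^sup>\<dagger> *\<^sub>v (F *\<^sub>v y))"
      using cip_adjoint[of "x - F *\<^sub>v x" A "F *\<^sub>v y"] x y d by simp
    also have "\<dots> = (x - F *\<^sub>v x) \<bullet>c (F *\<^sub>v (A\<^sup>\<dagger> *\<^sub>v (F *\<^sub>v y)))"
      using AdjF[OF y] by simp
    also have "\<dots> = (F *\<^sub>v (x - F *\<^sub>v x)) \<bullet>c (A\<^sup>\<dagger> *\<^sub>v (F *\<^sub>v y))"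
      using sym[of "x - F *\<^sub>v x" "A\<^sup>\<dagger> *\<^sub>v (F *\<^sub>v y)"] x y d by simp
    also have "F *\<^sub>v (x - F *\<^sub>v x) = 0\<^sub>v k"
      using x d FF minus_cancel_vec[OF carrier_vecI[of "F *\<^sub>v x" k]] by (simp add: mult_vec_diff)
    finally show "(F *\<^sub>v (A1 *\<^sub>v x)) \<bullet>c y = 0" using d by simp
  qed (use d in simp)
  have FA1': "F *\<^sub>v (A1\<^sup>\<dagger> *\<^sub>v x) = 0\<^sub>v k" if x: "dim_vec x = k" for x
  proof (rule zero)
    fix y :: "complex vec" assume y: "dim_vec y = k"
    have "(F *\<^sub>v (A1\<^sup>\<dagger> *\<^sub>v x)) \<bullet>c y = x \<bullet>c (A1 *\<^sub>v (F *\<^sub>v y))"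
      using sym[of "A1\<^sup>\<dagger> *\<^sub>v x" y] cip_adjoint[of x "A1\<^sup>\<dagger>" "F *\<^sub>v y"] x y d1 by simp
    then show "(F *\<^sub>v (A1\<^sup>\<dagger> *\<^sub>v x)) \<bullet>c y = 0" using A1F[OF y] x by simp
  qed (use d in simp)
  have Qcip: "(Q *\<^sub>v x) \<bullet>c y = (G1 *\<^sub>v x) \<bullet>c (G1 *\<^sub>v y)" if "dim_vec x = k" "dim_vec y = k" for x y
    using cip_adjoint[of "G1 *\<^sub>v x" "G1\<^sup>\<dagger>" y] that d1 by (simp add: Qx)
  have FQ: "F *\<^sub>v (Q *\<^sub>v x) = 0\<^sub>v k" if x: "dim_vec x = k" for x
  proof (rule zero)
    fix y :: "complex vec" assume y: "dim_vec y = k"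
    have "(F *\<^sub>v (Q *\<^sub>v x)) \<bullet>c y = (G1 *\<^sub>v x) \<bullet>c (G1 *\<^sub>v (F *\<^sub>v y))"
      using sym[of "Q *\<^sub>v x" y] Qcip[OF x, of "F *\<^sub>v y"] y d1 by simp
    then show "(F *\<^sub>v (Q *\<^sub>v x)) \<bullet>c y = 0" using G1F[OF y] d1 by simp
  qed (use d in simp)
  have psdQ: "psd k Q"
    unfolding psd_def
  proof (intro conjI allI impI)
    show "Q\<^sup>\<dagger> = Q" unfolding Q_def using d1 by (simp add: adjoint_mult)
    show "0 \<le> Re ((Q *\<^sub>v x) \<bullet>c x)" if "dim_vec x = k" for x
      using Qcip[OF that that] sq_norm_vec_ge0[of "G1 *\<^sub>v x"] by (simp add: sq_norm_vec_def)
  qed (rule Q)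
  have "\<exists>X. psd k X \<and> (\<forall>x. dim_vec x = k \<longrightarrow> F *\<^sub>v (X *\<^sub>v x) = 0\<^sub>v k) \<and> riccati_mat A1 \<alpha> Q X = 0\<^sub>m k k"
  proof (rule riccati_solution_exists[OF A1 \<alpha> psdQ F FA1' FQ])
    fix Y assume Y: "psd k Y" and FY: "\<And>x. dim_vec x = k \<Longrightarrow> F *\<^sub>v (Y *\<^sub>v x) = 0\<^sub>v k"
      and \<alpha>Y: "\<And>x. dim_vec x = k \<Longrightarrow> \<alpha>\<^sup>\<dagger> *\<^sub>v (Y *\<^sub>v x) = 0\<^sub>v m"
      and inv: "\<And>x. dim_vec x = k \<Longrightarrow> Y *\<^sub>v x = 0\<^sub>v k \<Longrightarrow> Y *\<^sub>v (A1 *\<^sub>v x) = 0\<^sub>v k"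
    have hY: "Y\<^sup>\<dagger> = Y" and dY: "dim_row Y = k" "dim_col Y = k" using Y by (auto simp: psd_def)
    have YR: "Y *\<^sub>v reach_vec A \<alpha> j u = 0\<^sub>v k" if u: "dim_vec u = m" for j u
    proof (induction j)
      case 0
      have "Y *\<^sub>v (\<alpha> *\<^sub>v u) = 0\<^sub>v k"
      proof (rule zero)
        fix x :: "complex vec" assume x: "dim_vec x = k"
        have "(Y *\<^sub>v (\<alpha> *\<^sub>v u)) \<bullet>c x = u \<bullet>c (\<alpha>\<^sup>\<dagger> *\<^sub>v (Y *\<^sub>v x))"
          using hermitian_cip[OF hY, of "\<alpha> *\<^sub>v u" x] cip_adjoint[of u \<alpha> "Y *\<^sub>v x"] u x d dY by simp
        then show "(Y *\<^sub>v (\<alpha> *\<^sub>v u)) \<bullet>c x = 0" using \<alpha>Y[OF x] u by simp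
      qed (use dY in simp)
      then show ?case by simp
    next
      case (Suc j)
      have "A1 *\<^sub>v reach_vec A \<alpha> j u = A *\<^sub>v reach_vec A \<alpha> j u"
        using FR[OF u, of j] rd[of j u] minus_zero_vec[OF carrier_vecI[OF rd]] by (simp add: A1x)
      then show ?case using inv[OF rd Suc.IH] by simp
    qed
    show "Y = 0\<^sub>m k k"
    proof (rule psd_eq_zero[OF Y])
      fix x :: "complex vec" assume x: "dim_vec x = k"
      have "F *\<^sub>v (Y *\<^sub>v x) = Y *\<^sub>v x"
      proof (rule fix_F)
        show "reach_vec A \<alpha> j u \<bullet>c (Y *\<^sub>v x) = 0" if u: "dim_vec u = m" for j u
          using hermitian_cip[OF hY, of "reach_vec A \<alpha> j u" x] YR[OF u, of j] x dY rd by simp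
      qed (use dY in simp)
      then show "Y *\<^sub>v x = 0\<^sub>v k" using FY[OF x] by simp
    qed
  qed
  then obtain X where X: "psd k X" "\<And>x. dim_vec x = k \<Longrightarrow> F *\<^sub>v (X *\<^sub>v x) = 0\<^sub>v k" "riccati_mat A1 \<alpha> Q X = 0\<^sub>m k k"
    by blast
  have "F *\<^sub>v (\<alpha> *\<^sub>v u) = 0\<^sub>v k" if "dim_vec u = m" for u
    using FR[OF that, of 0] by simp
  then show ?thesis
    by (rule that[OF F _ FA1[unfolded A1_def] X(1,2) X(3)[unfolded A1_def Q_def G1_def]])
qed

text \<open>At all but finitely many points the state \<open>y(z)\<close> is computed from the modified matrix
  \<open>L' = A (I - F) - \<alpha> \<alpha>\<^sup>\<dagger> X\<close>: applying \<open>F\<close> to \<open>(z I - L') x = \<alpha> u\<close> gives \<open>z F x = 0\<close>, and vectors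
  with \<open>F x = 0\<close> do not distinguish \<open>L'\<close> from \<open>\<Lambda> + \<alpha> \<beta>\<close>. In terms of \<open>a = u - \<alpha>\<^sup>\<dagger> X y\<close> the system
  reads \<open>z y = A y + \<alpha> a\<close> with output \<open>G y + R a\<close>, an orthogonal sum, and the Riccati equation
  yields the energy balance.\<close>

lemma inner_feedback_exists:
  assumes \<Lambda>: "\<Lambda> \<in> carrier_mat k k" and \<alpha>: "\<alpha> \<in> carrier_mat k m" and H: "H \<in> carrier_mat q k"
    and R: "R \<in> carrier_mat q m" and iso: "R\<^sup>\<dagger> * R = 1\<^sub>m m"
  obtains \<beta> X bad where "\<beta> \<in> carrier_mat m k" "psd k X" "finite bad"
    "\<And>z. z \<notin> bad \<Longrightarrow> poly (char_poly (\<Lambda> + \<alpha> * \<beta>)) z \<noteq> 0"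
    "\<And>z w u u'. z \<notin> bad \<Longrightarrow> w \<notin> bad \<Longrightarrow> dim_vec u = m \<Longrightarrow> dim_vec u' = m \<Longrightarrow>
       (R *\<^sub>v u + (H + R * \<beta>) *\<^sub>v (resolvent_at (\<Lambda> + \<alpha> * \<beta>) z *\<^sub>v (\<alpha> *\<^sub>v u)))
         \<bullet>c (R *\<^sub>v u' + (H + R * \<beta>) *\<^sub>v (resolvent_at (\<Lambda> + \<alpha> * \<beta>) w *\<^sub>v (\<alpha> *\<^sub>v u')))
       = u \<bullet>c u' - (z + cnj w) * ((X *\<^sub>v (resolvent_at (\<Lambda> + \<alpha> * \<beta>) z *\<^sub>v (\<alpha> *\<^sub>v u)))
           \<bullet>c (resolvent_at (\<Lambda> + \<alpha> * \<beta>) w *\<^sub>v (\<alpha> *\<^sub>v u')))"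
proof -
  define A where "A = \<Lambda> - \<alpha> * (R\<^sup>\<dagger> * H)"
  define G where "G = H - R * (R\<^sup>\<dagger> * H)"
  note d0 = carrier_matD[OF \<Lambda>] carrier_matD[OF \<alpha>] carrier_matD[OF H] carrier_matD[OF R]
  have A: "A \<in> carrier_mat k k" and G: "G \<in> carrier_mat q k"
    using d0 by (auto simp: A_def G_def)
  have Ax: "A *\<^sub>v x = \<Lambda> *\<^sub>v x - \<alpha> *\<^sub>v (R\<^sup>\<dagger> *\<^sub>v (H *\<^sub>v x))" if "dim_vec x = k" for x
    unfolding A_def using that d0 by (simp add: diff_mult_vec mult_mult_vec)
  have Gx: "G *\<^sub>v x = H *\<^sub>v x - R *\<^sub>v (R\<^sup>\<dagger> *\<^sub>v (H *\<^sub>v x))" if "dim_vec x = k" for x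
    unfolding G_def using that d0 by (simp add: diff_mult_vec mult_mult_vec)
  have RR: "R\<^sup>\<dagger> *\<^sub>v (R *\<^sub>v u) = u" if "dim_vec u = m" for u
    using mult_mult_vec[of "R\<^sup>\<dagger>" R u] that d0 by (simp add: iso one_mult_vec)
  have RG: "R\<^sup>\<dagger> *\<^sub>v (G *\<^sub>v x) = 0\<^sub>v m" if "dim_vec x = k" for x
    using that d0 minus_cancel_vec[OF carrier_vecI[of "R\<^sup>\<dagger> *\<^sub>v (H *\<^sub>v x)" m]]
    by (simp add: Gx mult_vec_diff RR)
  obtain F X where F: "F \<in> carrier_mat k k"
    and F\<alpha>: "\<And>u. dim_vec u = m \<Longrightarrow> F *\<^sub>v (\<alpha> *\<^sub>v u) = 0\<^sub>v k"
    and FA: "\<And>x. dim_vec x = k \<Longrightarrow> F *\<^sub>v ((A - A * F) *\<^sub>v x) = 0\<^sub>v k"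
    and psdX: "psd k X" and FX: "\<And>x. dim_vec x = k \<Longrightarrow> F *\<^sub>v (X *\<^sub>v x) = 0\<^sub>v k"
    and ric: "riccati_mat (A - A * F) \<alpha> ((G - G * F)\<^sup>\<dagger> * (G - G * F)) X = 0\<^sub>m k k"
    using unreachable_projection_riccati[OF A \<alpha> G] by blast
  have X: "X \<in> carrier_mat k k" "X\<^sup>\<dagger> = X" using psdX by (auto simp: psd_def)
  define A1 where "A1 = A - A * F"
  define G1 where "G1 = G - G * F"
  note d = d0 carrier_matD[OF A] carrier_matD[OF G] carrier_matD[OF F] carrier_matD[OF X(1)]
  have A1: "A1 \<in> carrier_mat k k" and G1: "G1 \<in> carrier_mat q k" and Q: "G1\<^sup>\<dagger> * G1 \<in> carrier_mat k k"
    using d by (auto simp: A1_def G1_def)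
  note d1 = d carrier_matD[OF A1] carrier_matD[OF G1]
  have A1x: "A1 *\<^sub>v x = A *\<^sub>v x" and G1x: "G1 *\<^sub>v x = G *\<^sub>v x"
    if "dim_vec x = k" "F *\<^sub>v x = 0\<^sub>v k" for x
    unfolding A1_def G1_def
    using that d minus_zero_vec[OF carrier_vecI[of "A *\<^sub>v x" k]] minus_zero_vec[OF carrier_vecI[of "G *\<^sub>v x" q]]
    by (simp_all add: diff_mult_vec mult_mult_vec mult_vec_zero)
  define \<beta> where "\<beta> = - 1 \<cdot>\<^sub>m (R\<^sup>\<dagger> * H + \<alpha>\<^sup>\<dagger> * X)"
  define L where "L = \<Lambda> + \<alpha> * \<beta>"
  define L' where "L' = A1 - \<alpha> * (\<alpha>\<^sup>\<dagger> * X)"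
  have \<beta>: "\<beta> \<in> carrier_mat m k" using d by (auto simp: \<beta>_def)
  have L: "L \<in> carrier_mat k k" and L': "L' \<in> carrier_mat k k"
    using d1 \<beta> by (auto simp: L_def L'_def)
  have \<beta>x: "\<beta> *\<^sub>v x = (-1) \<cdot>\<^sub>v (R\<^sup>\<dagger> *\<^sub>v (H *\<^sub>v x) + \<alpha>\<^sup>\<dagger> *\<^sub>v (X *\<^sub>v x))" if "dim_vec x = k" for x
    unfolding \<beta>_def using that d by (simp add: smult_mult_vec add_mult_vec mult_mult_vec)
  \<comment> \<open>The point \<open>0\<close> is excluded because \<open>F x = 0\<close> is inferred from \<open>z F x = 0\<close>.\<close>
  define bad where "bad = insert 0 ({z. poly (char_poly L) z = 0} \<union> {z. poly (char_poly L') z = 0})"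
  have fin: "finite bad"
    unfolding bad_def using poly_roots_finite char_poly_nonzero[OF L] char_poly_nonzero[OF L'] by auto
  define y where "y z u = resolvent_at L z *\<^sub>v (\<alpha> *\<^sub>v u)" for z u
  have state: "dim_vec (y z u) = k \<and> F *\<^sub>v y z u = 0\<^sub>v k \<and>
      z \<cdot>\<^sub>v y z u = A *\<^sub>v y z u + \<alpha> *\<^sub>v (u - \<alpha>\<^sup>\<dagger> *\<^sub>v (X *\<^sub>v y z u))"
    if z: "z \<notin> bad" and u: "dim_vec u = m" for z u
  proof -
    have nz: "z \<noteq> 0" "poly (char_poly L) z \<noteq> 0" "poly (char_poly L') z \<noteq> 0"
      using z by (auto simp: bad_def)
    note r = resolvent_at[OF L nz(2)] and r' = resolvent_at[OF L' nz(3)]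
    define x where "x = resolvent_at L' z *\<^sub>v (\<alpha> *\<^sub>v u)"
    have x: "dim_vec x = k" using r' by (simp add: x_def)
    define a where "a = u - \<alpha>\<^sup>\<dagger> *\<^sub>v (X *\<^sub>v x)"
    have a: "dim_vec a = m" using d by (simp add: a_def)
    have "(z \<cdot>\<^sub>m 1\<^sub>m k - L') *\<^sub>v x = ((z \<cdot>\<^sub>m 1\<^sub>m k - L') * resolvent_at L' z) *\<^sub>v (\<alpha> *\<^sub>v u)"
      unfolding x_def using r' L' d u by (subst mult_mult_vec) auto
    also have "\<dots> = \<alpha> *\<^sub>v u" using d by (simp add: r'(2) one_mult_vec)
    also have "(z \<cdot>\<^sub>m 1\<^sub>m k - L') *\<^sub>v x = z \<cdot>\<^sub>v x - (A1 *\<^sub>v x - \<alpha> *\<^sub>v (\<alpha>\<^sup>\<dagger> *\<^sub>v (X *\<^sub>v x)))"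
      unfolding L'_def using x d1 by (simp add: diff_mult_vec smult_mult_vec mult_mult_vec one_mult_vec)
    finally have e: "z \<cdot>\<^sub>v x - (A1 *\<^sub>v x - \<alpha> *\<^sub>v (\<alpha>\<^sup>\<dagger> *\<^sub>v (X *\<^sub>v x))) = \<alpha> *\<^sub>v u" .
    have e1: "z \<cdot>\<^sub>v x = A1 *\<^sub>v x + \<alpha> *\<^sub>v a"
    proof (rule eq_vecI)
      fix i assume i: "i < dim_vec (A1 *\<^sub>v x + \<alpha> *\<^sub>v a)"
      then have "(z \<cdot>\<^sub>v x - (A1 *\<^sub>v x - \<alpha> *\<^sub>v (\<alpha>\<^sup>\<dagger> *\<^sub>v (X *\<^sub>v x)))) $ i = (\<alpha> *\<^sub>v u) $ i"
        by (simp only: e)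
      moreover have "\<alpha> *\<^sub>v a = \<alpha> *\<^sub>v u - \<alpha> *\<^sub>v (\<alpha>\<^sup>\<dagger> *\<^sub>v (X *\<^sub>v x))"
        unfolding a_def using u d by (simp add: mult_vec_diff)
      ultimately show "(z \<cdot>\<^sub>v x) $ i = (A1 *\<^sub>v x + \<alpha> *\<^sub>v a) $ i"
        using i x d1 by (simp del: index_mult_mat_vec add: algebra_simps)
    qed (use x d in simp)
    have "F *\<^sub>v (z \<cdot>\<^sub>v x) = 0\<^sub>v k"
      using a d1 FA[OF x] F\<alpha>[OF a] by (simp add: e1 mult_vec_add A1_def)
    then have "z \<cdot>\<^sub>v (F *\<^sub>v x) = 0\<^sub>v k" using x d by (simp add: mult_vec_smult)
    then have "z * (F *\<^sub>v x) $ i = 0" if "i < k" for i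
      using that d by (metis index_smult_vec(1) dim_mult_mat_vec index_zero_vec(1))
    then have Fx: "F *\<^sub>v x = 0\<^sub>v k" using nz(1) d by (intro eq_vecI) (auto simp del: index_mult_mat_vec)
    have e2: "z \<cdot>\<^sub>v x = A *\<^sub>v x + \<alpha> *\<^sub>v a" using e1 A1x[OF x Fx] by simp
    have "(z \<cdot>\<^sub>m 1\<^sub>m k - L) *\<^sub>v x = z \<cdot>\<^sub>v x - (\<Lambda> *\<^sub>v x + \<alpha> *\<^sub>v (\<beta> *\<^sub>v x))"
      unfolding L_def using x d \<beta> by (simp add: diff_mult_vec add_mult_vec smult_mult_vec mult_mult_vec one_mult_vec)
    also have "\<dots> = \<alpha> *\<^sub>v u"
    proof (rule eq_vecI)
      fix i assume i: "i < dim_vec (\<alpha> *\<^sub>v u)"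
      show "(z \<cdot>\<^sub>v x - (\<Lambda> *\<^sub>v x + \<alpha> *\<^sub>v (\<beta> *\<^sub>v x))) $ i = (\<alpha> *\<^sub>v u) $ i"
        unfolding e2 a_def \<beta>x[OF x] using i x u d
        by (simp del: index_mult_mat_vec add: Ax mult_vec_smult mult_vec_add mult_vec_diff algebra_simps)
    qed (use d x in simp)
    finally have "resolvent_at L z *\<^sub>v ((z \<cdot>\<^sub>m 1\<^sub>m k - L) *\<^sub>v x) = y z u" by (simp add: y_def)
    moreover have "resolvent_at L z *\<^sub>v ((z \<cdot>\<^sub>m 1\<^sub>m k - L) *\<^sub>v x) = x"
      using mult_mult_vec[of "resolvent_at L z" "z \<cdot>\<^sub>m 1\<^sub>m k - L" x] r L x by (simp add: one_mult_vec)
    ultimately have "y z u = x" by simp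
    then show ?thesis using x Fx e2 by (simp add: a_def)
  qed
  have energy: "(R *\<^sub>v u + (H + R * \<beta>) *\<^sub>v y z u) \<bullet>c (R *\<^sub>v u' + (H + R * \<beta>) *\<^sub>v y w u')
      = u \<bullet>c u' - (z + cnj w) * ((X *\<^sub>v y z u) \<bullet>c y w u')"
    if z: "z \<notin> bad" and w: "w \<notin> bad" and u: "dim_vec u = m" and u': "dim_vec u' = m" for z w u u'
  proof -
    define x x' where "x = y z u" and "x' = y w u'"
    define b b' where "b = \<alpha>\<^sup>\<dagger> *\<^sub>v (X *\<^sub>v x)" and "b' = \<alpha>\<^sup>\<dagger> *\<^sub>v (X *\<^sub>v x')"
    define a a' where "a = u - b" and "a' = u' - b'"
    have x: "dim_vec x = k" "F *\<^sub>v x = 0\<^sub>v k" "z \<cdot>\<^sub>v x = A *\<^sub>v x + \<alpha> *\<^sub>v a"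
      using state[OF z u] by (auto simp: x_def a_def b_def)
    have x': "dim_vec x' = k" "F *\<^sub>v x' = 0\<^sub>v k" "w \<cdot>\<^sub>v x' = A *\<^sub>v x' + \<alpha> *\<^sub>v a'"
      using state[OF w u'] by (auto simp: x'_def a'_def b'_def)
    have dv: "dim_vec b = m" "dim_vec b' = m" "dim_vec a = m" "dim_vec a' = m"
      using d by (auto simp: b_def b'_def a_def a'_def)
    have out: "R *\<^sub>v v + (H + R * \<beta>) *\<^sub>v s = G *\<^sub>v s + R *\<^sub>v (v - \<alpha>\<^sup>\<dagger> *\<^sub>v (X *\<^sub>v s))"
      if "dim_vec v = m" "dim_vec s = k" for v s
    proof (rule eq_vecI)
      fix i assume "i < dim_vec (G *\<^sub>v s + R *\<^sub>v (v - \<alpha>\<^sup>\<dagger> *\<^sub>v (X *\<^sub>v s)))"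
      then show "(R *\<^sub>v v + (H + R * \<beta>) *\<^sub>v s) $ i = (G *\<^sub>v s + R *\<^sub>v (v - \<alpha>\<^sup>\<dagger> *\<^sub>v (X *\<^sub>v s))) $ i"
        using that d \<beta>
        by (simp del: index_mult_mat_vec
            add: add_mult_vec mult_mult_vec \<beta>x Gx mult_vec_smult mult_vec_add mult_vec_diff algebra_simps)
    qed (use that d \<beta> in simp)
    have GR: "(G *\<^sub>v s) \<bullet>c (R *\<^sub>v v) = 0" "(R *\<^sub>v v) \<bullet>c (G *\<^sub>v s) = 0" if "dim_vec s = k" "dim_vec v = m" for s v
      using cip_adjoint[of v R "G *\<^sub>v s"] cip_commute[of "G *\<^sub>v s" "R *\<^sub>v v"] that d RG by simp_all
    have RRc: "(R *\<^sub>v v) \<bullet>c (R *\<^sub>v v') = v \<bullet>c v'" if "dim_vec v = m" "dim_vec v' = m" for v v'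
      using cip_adjoint[of v R "R *\<^sub>v v'"] that d RR by simp
    have lhs: "(R *\<^sub>v u + (H + R * \<beta>) *\<^sub>v x) \<bullet>c (R *\<^sub>v u' + (H + R * \<beta>) *\<^sub>v x')
        = (G *\<^sub>v x) \<bullet>c (G *\<^sub>v x') + a \<bullet>c a'"
      unfolding out[OF u x(1)] out[OF u' x'(1)] b_def[symmetric] b'_def[symmetric] a_def[symmetric] a'_def[symmetric]
      using x(1) x'(1) dv d by (simp add: cip_simps GR RRc)
    have "(riccati_mat A1 \<alpha> (G1\<^sup>\<dagger> * G1) X *\<^sub>v x) \<bullet>c x' = 0"
      using x(1) x'(1) ric by (simp add: A1_def G1_def) (auto simp: scalar_prod_def)
    moreover have "(G1\<^sup>\<dagger> * G1 *\<^sub>v x) \<bullet>c x' = (G *\<^sub>v x) \<bullet>c (G *\<^sub>v x')"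
      using cip_adjoint[of "G1 *\<^sub>v x" "G1\<^sup>\<dagger>" x'] x x' d1 by (simp add: mult_mult_vec G1x)
    ultimately have ricc: "(A *\<^sub>v x) \<bullet>c (X *\<^sub>v x') + (X *\<^sub>v x) \<bullet>c (A *\<^sub>v x') - b \<bullet>c b' + (G *\<^sub>v x) \<bullet>c (G *\<^sub>v x') = 0"
      using riccati_mat_cip[OF A1 \<alpha> Q X x(1) x'(1)] x x' by (simp add: A1x b_def b'_def)
    have e1: "z * ((X *\<^sub>v x) \<bullet>c x') = (A *\<^sub>v x) \<bullet>c (X *\<^sub>v x') + a \<bullet>c b'"
    proof -
      have "z * ((X *\<^sub>v x) \<bullet>c x') = (z \<cdot>\<^sub>v x) \<bullet>c (X *\<^sub>v x')"
        using hermitian_cip[OF X(2), of x x'] x(1) x'(1) d by (simp add: cip_simps)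
      also have "\<dots> = (A *\<^sub>v x) \<bullet>c (X *\<^sub>v x') + a \<bullet>c b'"
        using cip_adjoint[of a \<alpha> "X *\<^sub>v x'"] dv d by (simp add: x(3) cip_simps b'_def)
      finally show ?thesis .
    qed
    have e2: "cnj w * ((X *\<^sub>v x) \<bullet>c x') = (X *\<^sub>v x) \<bullet>c (A *\<^sub>v x') + b \<bullet>c a'"
    proof -
      have "cnj w * ((X *\<^sub>v x) \<bullet>c x') = (X *\<^sub>v x) \<bullet>c (w \<cdot>\<^sub>v x')"
        using x(1) x'(1) d by (simp add: cip_simps)
      also have "\<dots> = (X *\<^sub>v x) \<bullet>c (A *\<^sub>v x') + b \<bullet>c a'"
        using cip_adjoint[of "X *\<^sub>v x" "\<alpha>\<^sup>\<dagger>" a'] dv d by (simp add: x'(3) cip_simps b_def)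
      finally show ?thesis .
    qed
    have "u \<bullet>c u' = (a + b) \<bullet>c (a' + b')"
      using u u' dv by (auto simp: a_def a'_def intro!: arg_cong2[where f = scalar_prod] arg_cong[where f = conjugate] eq_vecI)
    also have "\<dots> = a \<bullet>c a' + a \<bullet>c b' + b \<bullet>c a' + b \<bullet>c b'"
      using dv by (simp add: cip_simps)
    finally have uu: "u \<bullet>c u' = a \<bullet>c a' + a \<bullet>c b' + b \<bullet>c a' + b \<bullet>c b'" .
    have "(G *\<^sub>v x) \<bullet>c (G *\<^sub>v x') = ((A *\<^sub>v x) \<bullet>c (X *\<^sub>v x') + (X *\<^sub>v x) \<bullet>c (A *\<^sub>v x') - b \<bullet>c b'
        + (G *\<^sub>v x) \<bullet>c (G *\<^sub>v x')) + b \<bullet>c b' - ((A *\<^sub>v x) \<bullet>c (X *\<^sub>v x') + (X *\<^sub>v x) \<bullet>c (A *\<^sub>v x'))"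
      by simp
    also have "\<dots> = b \<bullet>c b' - ((A *\<^sub>v x) \<bullet>c (X *\<^sub>v x') + (X *\<^sub>v x) \<bullet>c (A *\<^sub>v x'))"
      unfolding ricc by simp
    finally have "u \<bullet>c u' - (z + cnj w) * ((X *\<^sub>v x) \<bullet>c x') = (G *\<^sub>v x) \<bullet>c (G *\<^sub>v x') + a \<bullet>c a'"
      unfolding distrib_right e1 e2 uu by simp
    then show ?thesis using lhs by (simp add: x_def x'_def)
  qed
  show ?thesis
  proof (rule that[OF \<beta> psdX fin])
    show "poly (char_poly (\<Lambda> + \<alpha> * \<beta>)) z \<noteq> 0" if "z \<notin> bad" for z
      using that by (simp add: bad_def L_def)
  qed (use energy in \<open>simp add: y_def L_def\<close>)
qed

section \<open>Rational functions and their values\<close>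

lemma quotient_eq_quot_of_fract:
  assumes r: "r = to_fract p / to_fract q" and q: "q \<noteq> 0"
  shows "fst (quot_of_fract r) * q = p * snd (quot_of_fract r)" "snd (quot_of_fract r) dvd q"
proof -
  let ?a = "fst (quot_of_fract r)" and ?b = "snd (quot_of_fract r)"
  have "to_fract ?a / to_fract ?b = to_fract p / to_fract q"
    using Fract_quot_of_fract[of r] r by (simp add: Fract_conv_to_fract)
  then have "to_fract (?a * q) = to_fract (p * ?b)"
    using q by (simp add: frac_eq_eq)
  then show eq: "?a * q = p * ?b" by (simp only: to_fract_eq_iff)
  then have "?b dvd ?a * q" by simp
  moreover have "coprime ?b ?a" using coprime_quot_of_fract[of r] by (simp add: coprime_commute)
  ultimately show "?b dvd q" by (simp add: coprime_dvd_mult_right_iff)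
qed

lemma rat_eval_quotient:
  assumes r: "r = to_fract p / to_fract q" and q: "poly q z \<noteq> 0"
  shows "\<not> rat_pole r z" "rat_eval r z = poly p z / poly q z"
proof -
  let ?a = "fst (quot_of_fract r)" and ?b = "snd (quot_of_fract r)"
  have "q \<noteq> 0" using q by auto
  note e = quotient_eq_quot_of_fract[OF r this]
  have b: "poly ?b z \<noteq> 0" using e(2) q by (auto elim!: dvdE)
  then show "\<not> rat_pole r z" by (simp add: rat_pole_def)
  have "poly ?a z * poly q z = poly p z * poly ?b z"
    using arg_cong[OF e(1), of "\<lambda>p. poly p z"] by simp
  then show "rat_eval r z = poly p z / poly q z"
    using b q by (simp add: rat_eval_def frac_eq_eq)
qed

lemma isCont_rat_eval: "\<not> rat_pole r z \<Longrightarrow> isCont (rat_eval r) z"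
  unfolding rat_eval_def[abs_def] rat_pole_def by (intro isCont_divide poly_isCont)

lemma rat_eval_analytic:
  assumes "open S" "\<And>z. z \<in> S \<Longrightarrow> \<not> rat_pole r z"
  shows "rat_eval r analytic_on S"
proof -
  have "(\<lambda>z. poly p z) field_differentiable (at z)" for p :: "complex poly" and z
    using poly_DERIV by (metis field_differentiable_def)
  then have "rat_eval r field_differentiable (at z)" if "z \<in> S" for z
    using assms(2)[OF that] unfolding rat_eval_def[abs_def] rat_pole_def
    by (intro field_differentiable_divide)
  then have "rat_eval r holomorphic_on S"
    by (simp add: holomorphic_on_def field_differentiable_at_within)
  then show ?thesis using assms(1) by (simp add: analytic_on_open)
qed

lemma eventually_avoid_finite:
  fixes z :: complex
  assumes "finite B"
  shows "\<forall>\<^sub>F \<zeta> in at z. \<zeta> \<notin> B"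
proof -
  have "open (- (B - {z}))" using assms by (intro open_Compl finite_imp_closed) simp
  then have "\<forall>\<^sub>F \<zeta> in nhds z. \<zeta> \<in> - (B - {z})" by (rule eventually_nhds_in_open) simp
  then show ?thesis by (auto simp: eventually_at_filter elim: eventually_mono)
qed

text \<open>At a pole the reduced numerator is nonzero, yet near the point it is bounded by a multiple of the
  denominator.\<close>

lemma bounded_imp_no_rat_pole:
  assumes "\<forall>\<^sub>F \<zeta> in at z. cmod (rat_eval r \<zeta>) \<le> c"
  shows "\<not> rat_pole r z"
proof
  let ?a = "fst (quot_of_fract r)" and ?b = "snd (quot_of_fract r)"
  assume "rat_pole r z"
  then have b0: "poly ?b z = 0" by (simp add: rat_pole_def)
  have a0: "poly ?a z \<noteq> 0"
    using coprime_poly_0[OF coprime_quot_of_fract[of r], of z] b0 by simp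
  have "finite {\<zeta>. poly ?b \<zeta> = 0}" by (rule poly_roots_finite) simp
  from eventually_avoid_finite[OF this] assms
  have le: "\<forall>\<^sub>F \<zeta> in at z. cmod (poly ?a \<zeta>) \<le> c * cmod (poly ?b \<zeta>)"
    by eventually_elim (simp add: rat_eval_def norm_divide divide_le_eq)
  have lim_a: "((\<lambda>\<zeta>. cmod (poly ?a \<zeta>)) \<longlongrightarrow> cmod (poly ?a z)) (at z)"
    by (intro tendsto_norm isContD poly_isCont)
  have lim_b: "((\<lambda>\<zeta>. c * cmod (poly ?b \<zeta>)) \<longlongrightarrow> c * cmod (poly ?b z)) (at z)"
    by (intro tendsto_mult tendsto_const tendsto_norm isContD poly_isCont)
  have "cmod (poly ?a z) \<le> c * cmod (poly ?b z)"
    by (rule tendsto_le[OF trivial_limit_at lim_b lim_a le])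
  then show False using a0 b0 by simp
qed

lemma resolvent_eq_num:
  assumes L: "L \<in> carrier_mat k k"
  shows "resolvent L = (1 / to_fract (char_poly L)) \<cdot>\<^sub>m map_mat to_fract (resolvent_num L)"
proof -
  let ?c = "1 / to_fract (char_poly L)" and ?N = "map_mat to_fract (resolvent_num L)"
  define Z where "Z = rat_z \<cdot>\<^sub>m 1\<^sub>m k - map_mat rat_const L"
  have N: "?N \<in> carrier_mat k k" and Z: "Z \<in> carrier_mat k k"
    using resolvent_num(1)[OF L] L by (auto simp: Z_def)
  have C: "map_mat to_fract (char_poly_matrix L) = Z"
  proof (rule eq_matI)
    fix i j assume ij: "i < dim_row Z" "j < dim_col Z"
    have "rat_z - rat_const c = to_fract [:- c, 1:]" "0 - rat_const c = to_fract [:- c:]" for c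
      by (simp_all add: rat_z_def rat_const_def flip: to_fract_diff to_fract_uminus)
    then show "map_mat to_fract (char_poly_matrix L) $$ (i, j) = Z $$ (i, j)"
      using L ij by (auto simp: Z_def char_poly_matrix_def)
  qed (use L carrier_matD[OF char_poly_matrix_closed[OF L]] in \<open>simp_all add: Z_def\<close>)
  have S: "map_mat to_fract (char_poly L \<cdot>\<^sub>m 1\<^sub>m k) = to_fract (char_poly L) \<cdot>\<^sub>m 1\<^sub>m k"
    by (intro eq_matI) auto
  have nz: "to_fract (char_poly L) \<noteq> 0" using char_poly_nonzero[OF L] by simp
  have "Z * ?N = to_fract (char_poly L) \<cdot>\<^sub>m 1\<^sub>m k"
    using semiring_hom.mat_hom_mult[OF semiring_hom_to_fract char_poly_matrix_closed[OF L] resolvent_num(1)[OF L]]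
    by (simp add: C S resolvent_num(2)[OF L])
  then have right: "Z * (?c \<cdot>\<^sub>m ?N) = 1\<^sub>m k"
    using nz mult_smult_distrib[OF Z N, of ?c] by (auto intro!: eq_matI)
  have "?N * Z = to_fract (char_poly L) \<cdot>\<^sub>m 1\<^sub>m k"
    using semiring_hom.mat_hom_mult[OF semiring_hom_to_fract resolvent_num(1)[OF L] char_poly_matrix_closed[OF L]]
    by (simp add: C S resolvent_num(3)[OF L])
  then have left: "(?c \<cdot>\<^sub>m ?N) * Z = 1\<^sub>m k"
    using nz mult_smult_assoc_mat[OF N Z, of ?c] by (auto intro!: eq_matI)
  have cN: "?c \<cdot>\<^sub>m ?N \<in> carrier_mat k k" using N by simp
  have "Z \<in> Units (ring_mat TYPE(ratfun) k ())"
    unfolding Units_def using Z cN left right by (auto simp: ring_mat_simps)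
  then obtain W where W: "mat_inverse Z = Some W"
    using mat_inverse(1)[OF Z, of "()"] by (cases "mat_inverse Z") auto
  from mat_inverse(2)[OF Z W] have W': "W * Z = 1\<^sub>m k" "W \<in> carrier_mat k k" by auto
  have "W = W * (Z * (?c \<cdot>\<^sub>m ?N))" using W' right by simp
  also have "\<dots> = W * Z * (?c \<cdot>\<^sub>m ?N)" by (rule assoc_mult_mat[OF W'(2) Z cN, symmetric])
  also have "\<dots> = ?c \<cdot>\<^sub>m ?N" unfolding W'(1) by (rule left_mult_one_mat[OF cN])
  finally show ?thesis using W L by (simp add: resolvent_def Z_def)
qed

lemma transfer_fun_carrier:
  assumes "L \<in> carrier_mat k k" "\<alpha> \<in> carrier_mat k m" "H \<in> carrier_mat q k" "R \<in> carrier_mat q m"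
  shows "transfer_fun L \<alpha> H R \<in> carrier_mat q m"
  using assms by (auto simp: transfer_fun_def)

lemma transfer_fun_eval:
  assumes L: "L \<in> carrier_mat k k" and \<alpha>: "\<alpha> \<in> carrier_mat k m" and H: "H \<in> carrier_mat q k"
    and R: "R \<in> carrier_mat q m" and z: "poly (char_poly L) z \<noteq> 0"
  shows "mat_eval (transfer_fun L \<alpha> H R) z = R + H * resolvent_at L z * \<alpha>"
proof -
  define cm :: "complex mat \<Rightarrow> complex poly mat" where "cm = map_mat (\<lambda>c. [:c:])"
  let ?N = "resolvent_num L" and ?\<chi> = "char_poly L"
  have rc: "map_mat rat_const M = map_mat to_fract (cm M)" for M
    by (intro eq_matI) (auto simp: cm_def rat_const_def)
  have ev: "map_mat (\<lambda>p. poly p z) (cm M) = M" for M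
    by (intro eq_matI) (auto simp: cm_def)
  have cc: "cm M \<in> carrier_mat a b" if "M \<in> carrier_mat a b" for M a b using that by (simp add: cm_def)
  note N = resolvent_num(1)[OF L]
  have HN: "cm H * ?N \<in> carrier_mat q k" using cc[OF H] N by simp
  define W where "W = cm H * ?N * cm \<alpha>"
  have W: "W \<in> carrier_mat q m" using HN cc[OF \<alpha>] by (simp add: W_def)
  define P where "P = ?\<chi> \<cdot>\<^sub>m cm R + W"
  have P: "P \<in> carrier_mat q m" using cc[OF R] W by (auto simp: P_def)
  have HNa: "map_mat h W = map_mat h (cm H) * map_mat h ?N * map_mat h (cm \<alpha>)"
    if "semiring_hom h" for h :: "complex poly \<Rightarrow> 'b :: comm_ring_1"
    using semiring_hom.mat_hom_mult[OF that cc[OF H] N] semiring_hom.mat_hom_mult[OF that HN cc[OF \<alpha>]]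
    by (simp add: W_def)
  have "map_mat to_fract (cm H) * ((1 / to_fract ?\<chi>) \<cdot>\<^sub>m map_mat to_fract ?N) * map_mat to_fract (cm \<alpha>)
      = (1 / to_fract ?\<chi>) \<cdot>\<^sub>m map_mat to_fract W"
    unfolding HNa[OF semiring_hom_to_fract]
    using cc[OF H] N cc[OF \<alpha>]
    by (simp add: mult_smult_distrib[of _ q k _ k] mult_smult_assoc_mat[of _ q k _ m])
  then have K: "transfer_fun L \<alpha> H R = map_mat to_fract (cm R) + (1 / to_fract ?\<chi>) \<cdot>\<^sub>m map_mat to_fract W"
    by (simp add: transfer_fun_def resolvent_eq_num[OF L] rc)
  have entry: "transfer_fun L \<alpha> H R $$ (i, j) = to_fract (P $$ (i, j)) / to_fract ?\<chi>"
    if "i < q" "j < m" for i j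
    using that cc[OF R] W char_poly_nonzero[OF L] by (simp add: K P_def add_divide_distrib)
  have evP: "map_mat (\<lambda>p. poly p z) P = poly ?\<chi> z \<cdot>\<^sub>m R + H * map_mat (\<lambda>p. poly p z) ?N * \<alpha>"
  proof -
    have "map_mat (\<lambda>p. poly p z) P = map_mat (\<lambda>p. poly p z) (?\<chi> \<cdot>\<^sub>m cm R) + map_mat (\<lambda>p. poly p z) W"
      unfolding P_def using cc[OF R] W by (intro eq_matI) auto
    moreover have "map_mat (\<lambda>p. poly p z) (?\<chi> \<cdot>\<^sub>m cm R) = poly ?\<chi> z \<cdot>\<^sub>m R"
      by (intro eq_matI) (auto simp: cm_def)
    ultimately show ?thesis by (simp add: HNa[OF semiring_hom_poly] ev)
  qed
  show ?thesis
  proof (rule eq_matI)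
    fix i j assume "i < dim_row (R + H * resolvent_at L z * \<alpha>)" "j < dim_col (R + H * resolvent_at L z * \<alpha>)"
    then have ij: "i < q" "j < m" using H \<alpha> by auto
    have "mat_eval (transfer_fun L \<alpha> H R) z $$ (i, j) = rat_eval (transfer_fun L \<alpha> H R $$ (i, j)) z"
      using ij transfer_fun_carrier[OF L \<alpha> H R] by (simp add: mat_eval_def)
    also have "\<dots> = poly (P $$ (i, j)) z / poly ?\<chi> z"
      by (rule rat_eval_quotient(2)[OF entry[OF ij] z])
    also have "poly (P $$ (i, j)) z = (poly ?\<chi> z \<cdot>\<^sub>m R + H * map_mat (\<lambda>p. poly p z) ?N * \<alpha>) $$ (i, j)"
      using ij P by (simp flip: evP)
    also have "\<dots> / poly ?\<chi> z = R $$ (i, j) + (1 / poly ?\<chi> z) * (H * map_mat (\<lambda>p. poly p z) ?N * \<alpha>) $$ (i, j)"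
      using ij R H N \<alpha> z by (simp add: add_divide_distrib del: index_mult_mat(1))
    also have "\<dots> = (R + H * resolvent_at L z * \<alpha>) $$ (i, j)"
    proof -
      have "H * resolvent_at L z * \<alpha> = (1 / poly ?\<chi> z) \<cdot>\<^sub>m (H * map_mat (\<lambda>p. poly p z) ?N * \<alpha>)"
        unfolding resolvent_at_def using H N \<alpha>
        by (simp add: mult_smult_distrib[of _ q k _ k] mult_smult_assoc_mat[of _ q k _ m])
      then show ?thesis using ij R H N \<alpha> by (simp del: index_mult_mat(1))
    qed
    finally show "mat_eval (transfer_fun L \<alpha> H R) z $$ (i, j) = (R + H * resolvent_at L z * \<alpha>) $$ (i, j)" .
  qed (use transfer_fun_carrier[OF L \<alpha> H R] R H \<alpha> in \<open>auto simp: mat_eval_def\<close>)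
qed

section \<open>Inner functions\<close>

text \<open>Finitely many exceptional points do no harm: contractivity off a finite set already excludes
  poles, and both sides of the identity are continuous at the points where the identity is
  claimed.\<close>

lemma tall_innerI:
  assumes K: "K \<in> carrier_mat q m" and fin: "finite bad"
    and contr: "\<And>z i j. z \<notin> bad \<Longrightarrow> 0 < Re z \<Longrightarrow> i < q \<Longrightarrow> j < m \<Longrightarrow> cmod (mat_eval K z $$ (i, j)) \<le> 1"
    and ident: "\<And>z. z \<notin> bad \<Longrightarrow> - cnj z \<notin> bad \<Longrightarrow> para_hermitian K z * mat_eval K z = 1\<^sub>m m"
  shows "tall_inner K"
  unfolding tall_inner_def
proof (intro conjI ballI allI impI)
  have half: "open {z. 0 < Re z}" by (rule open_halfspace_Re_gt)
  fix r assume "r \<in> elements_mat K"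
  then obtain i j where ij: "i < q" "j < m" "r = K $$ (i, j)"
    using elements_matD[of r K] K by auto
  show "rat_eval r analytic_on {z. 0 < Re z}"
  proof (rule rat_eval_analytic[OF half])
    fix z :: complex assume "z \<in> {z. 0 < Re z}"
    then have "\<forall>\<^sub>F \<zeta> in at z. \<zeta> \<in> {z. 0 < Re z}"
      using half by (simp add: eventually_at_in_open' del: mem_Collect_eq)
    with eventually_avoid_finite[OF fin] have "\<forall>\<^sub>F \<zeta> in at z. cmod (rat_eval r \<zeta>) \<le> 1"
      by eventually_elim (use contr ij K in \<open>auto simp: mat_eval_def\<close>)
    then show "\<not> rat_pole r z" by (rule bounded_imp_no_rat_pole)
  qed
next
  fix z assume np: "\<not> mat_pole K z \<and> \<not> mat_pole K (- cnj z)"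
  have cont: "isCont (\<lambda>\<zeta>. rat_eval (K $$ (i, j)) \<zeta>) z" "isCont (\<lambda>\<zeta>. rat_eval (K $$ (i, j)) \<zeta>) (- cnj z)"
    if "i < q" "j < m" for i j
    using np elements_matI[OF K that refl] by (auto simp: mat_pole_def intro!: isCont_rat_eval)
  have entry: "(para_hermitian K \<zeta> * mat_eval K \<zeta>) $$ (i, j)
      = (\<Sum>l<q. cnj (rat_eval (K $$ (l, i)) (- cnj \<zeta>)) * rat_eval (K $$ (l, j)) \<zeta>)"
    if "i < m" "j < m" for i j \<zeta>
    using that K by (auto simp: para_hermitian_def mat_eval_def scalar_prod_def atLeast0LessThan intro!: sum.cong)
  have "finite ((\<lambda>\<zeta>. - cnj \<zeta>) -` bad)"
    by (intro finite_vimageI fin) (auto simp: inj_def)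
  then have ev: "\<forall>\<^sub>F \<zeta> in at z. \<zeta> \<notin> bad \<and> - cnj \<zeta> \<notin> bad"
    using eventually_avoid_finite[OF fin] eventually_avoid_finite[of "(\<lambda>\<zeta>. - cnj \<zeta>) -` bad"]
    by (simp add: eventually_conj_iff)
  show "para_hermitian K z * mat_eval K z = 1\<^sub>m (dim_col K)"
  proof (rule eq_matI)
    fix i j assume "i < dim_row (1\<^sub>m (dim_col K) :: complex mat)" "j < dim_col (1\<^sub>m (dim_col K) :: complex mat)"
    then have ij: "i < m" "j < m" using K by auto
    let ?f = "\<lambda>\<zeta>. \<Sum>l<q. cnj (rat_eval (K $$ (l, i)) (- cnj \<zeta>)) * rat_eval (K $$ (l, j)) \<zeta>"
    have "isCont (\<lambda>\<zeta>. rat_eval (K $$ (l, i)) (- cnj \<zeta>)) z" if "l < q" for l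
      by (rule isCont_o2[of _ "\<lambda>\<zeta>. - cnj \<zeta>"]) (auto intro!: continuous_intros cont(2) that ij)
    then have "isCont ?f z"
      using ij by (intro continuous_sum isCont_mult continuous_cnj cont(1)) auto
    then have "(?f \<longlongrightarrow> ?f z) (at z)" by (simp add: isCont_def)
    moreover have "\<forall>\<^sub>F \<zeta> in at z. ?f \<zeta> = (1\<^sub>m m :: complex mat) $$ (i, j)"
      using ev by eventually_elim (simp add: entry[OF ij, symmetric] ident)
    then have "(?f \<longlongrightarrow> (1\<^sub>m m :: complex mat) $$ (i, j)) (at z)"
      by (rule tendsto_eventually)
    ultimately have "?f z = (1\<^sub>m m :: complex mat) $$ (i, j)"
      by (rule tendsto_unique[OF trivial_limit_at])
    then show "(para_hermitian K z * mat_eval K z) $$ (i, j) = (1\<^sub>m (dim_col K) :: complex mat) $$ (i, j)"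
      using entry[OF ij] K by simp
  qed (auto simp: para_hermitian_def mat_eval_def)
qed

theorem theorem3p6:
  fixes A B C D H \<Lambda> P R\<^sub>0 \<alpha>\<^sub>0 :: "complex mat"
    and F :: "ratfun mat"
    and n q p k m :: nat
  assumes A: "A \<in> carrier_mat n n"
    and B: "B \<in> carrier_mat n q"
    and C: "C \<in> carrier_mat p n"
    and D: "D \<in> carrier_mat p q"
    and F: "F = transfer_fun A B C D"
    and observable: "observable_pair C A"
    and H: "H \<in> carrier_mat q k"
    and \<Lambda>: "\<Lambda> \<in> carrier_mat k k"
    and basis: "cols_basis_mod (fzk_space F) (fzk_null F) (map_mat rat_const H * resolvent \<Lambda>)"
    and Pi: "P \<in> carrier_mat n k"
    and sylvester: "A * P + B * H = P * \<Lambda>"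
    and output_zero: "C * P + D * H = 0\<^sub>m p k"
    and maximal: "maximal_orthonormal_solution B D P m R\<^sub>0 \<alpha>\<^sub>0"
  shows "\<exists>\<beta> \<in> carrier_mat m k.
           tall_inner (transfer_fun (\<Lambda> + \<alpha>\<^sub>0 * \<beta>) \<alpha>\<^sub>0 (H + R\<^sub>0 * \<beta>) R\<^sub>0)"
proof -
  have R: "R\<^sub>0 \<in> carrier_mat q m" and \<alpha>: "\<alpha>\<^sub>0 \<in> carrier_mat k m" and iso: "R\<^sub>0\<^sup>\<dagger> * R\<^sub>0 = 1\<^sub>m m"
    using maximal B Pi by (auto simp: maximal_orthonormal_solution_def kernel_solution_def)
  obtain \<beta> X bad where \<beta>: "\<beta> \<in> carrier_mat m k" and X: "psd k X" and fin: "finite bad"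
    and pole: "\<And>z. z \<notin> bad \<Longrightarrow> poly (char_poly (\<Lambda> + \<alpha>\<^sub>0 * \<beta>)) z \<noteq> 0"
    and energy: "\<And>z w u u'. z \<notin> bad \<Longrightarrow> w \<notin> bad \<Longrightarrow> dim_vec u = m \<Longrightarrow> dim_vec u' = m \<Longrightarrow>
       (R\<^sub>0 *\<^sub>v u + (H + R\<^sub>0 * \<beta>) *\<^sub>v (resolvent_at (\<Lambda> + \<alpha>\<^sub>0 * \<beta>) z *\<^sub>v (\<alpha>\<^sub>0 *\<^sub>v u)))
         \<bullet>c (R\<^sub>0 *\<^sub>v u' + (H + R\<^sub>0 * \<beta>) *\<^sub>v (resolvent_at (\<Lambda> + \<alpha>\<^sub>0 * \<beta>) w *\<^sub>v (\<alpha>\<^sub>0 *\<^sub>v u')))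
       = u \<bullet>c u' - (z + cnj w) * ((X *\<^sub>v (resolvent_at (\<Lambda> + \<alpha>\<^sub>0 * \<beta>) z *\<^sub>v (\<alpha>\<^sub>0 *\<^sub>v u)))
           \<bullet>c (resolvent_at (\<Lambda> + \<alpha>\<^sub>0 * \<beta>) w *\<^sub>v (\<alpha>\<^sub>0 *\<^sub>v u')))"
    using inner_feedback_exists[OF \<Lambda> \<alpha> H R iso] by blast
  define L where "L = \<Lambda> + \<alpha>\<^sub>0 * \<beta>"
  define H' where "H' = H + R\<^sub>0 * \<beta>"
  define K where "K = transfer_fun L \<alpha>\<^sub>0 H' R\<^sub>0"
  have L: "L \<in> carrier_mat k k" and H': "H' \<in> carrier_mat q k"
    using \<Lambda> \<alpha> \<beta> H R by (auto simp: L_def H'_def)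
  have K: "K \<in> carrier_mat q m" unfolding K_def by (rule transfer_fun_carrier[OF L \<alpha> H' R])
  define Y where "Y z u = resolvent_at L z *\<^sub>v (\<alpha>\<^sub>0 *\<^sub>v u)" for z u
  have Kc: "mat_eval K z \<in> carrier_mat q m" for z using K by (simp add: mat_eval_def)
  have Ku: "mat_eval K z *\<^sub>v u = R\<^sub>0 *\<^sub>v u + H' *\<^sub>v Y z u" if "z \<notin> bad" "dim_vec u = m" for z u
  proof -
    have z: "poly (char_poly L) z \<noteq> 0" using pole[OF that(1)] by (simp add: L_def)
    show ?thesis
      unfolding K_def transfer_fun_eval[OF L \<alpha> H' R z] Y_def
      using that resolvent_at(1)[OF L z] R H' \<alpha> by (simp add: add_mult_vec mult_mult_vec)
  qed
  \<comment> \<open>Contractivity is the case \<open>w = z\<close>, \<open>u' = u\<close>; the para-hermitian identity is \<open>w = - cnj z\<close>.\<close>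
  have E: "(mat_eval K z *\<^sub>v u) \<bullet>c (mat_eval K w *\<^sub>v u') = u \<bullet>c u' - (z + cnj w) * ((X *\<^sub>v Y z u) \<bullet>c Y w u')"
    if "z \<notin> bad" "w \<notin> bad" "dim_vec u = m" "dim_vec u' = m" for z w u u'
    using energy[OF that] that by (simp add: Ku Y_def L_def H'_def)
  have "tall_inner K"
  proof (rule tall_innerI[OF K fin])
    fix z i j assume z: "z \<notin> bad" "0 < Re z" and ij: "i < q" "j < m"
    have Yd: "dim_vec (Y z (unit_vec m j)) = k"
      using carrier_matD(1)[OF resolvent_at(1)[OF L pole[OF z(1), folded L_def]]] by (simp add: Y_def)
    define f where "f = Re ((X *\<^sub>v Y z (unit_vec m j)) \<bullet>c Y z (unit_vec m j))"
    have f0: "0 \<le> f"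
      using X Yd by (simp add: psd_def f_def)
    have f: "(X *\<^sub>v Y z (unit_vec m j)) \<bullet>c Y z (unit_vec m j) = of_real f"
      unfolding f_def using X Yd by (intro hermitian_form_real[of X k]) (auto simp: psd_def)
    have one: "(unit_vec m j :: complex vec) \<bullet>c unit_vec m j = 1"
      using cip_unit_vec[OF one_carrier_mat ij(2) ij(2)] ij by (simp add: one_mult_vec)
    have "sq_norm_vec (mat_eval K z *\<^sub>v unit_vec m j) = 1 - 2 * Re z * f"
      unfolding sq_norm_vec_def E[OF z(1) z(1) index_unit_vec(3) index_unit_vec(3)] one f by simp
    also have "\<dots> \<le> 1" using f0 z(2) by simp
    finally have le: "sq_norm_vec (mat_eval K z *\<^sub>v unit_vec m j) \<le> 1" .
    have "(cmod (mat_eval K z $$ (i, j)))\<^sup>2 = (cmod ((mat_eval K z *\<^sub>v unit_vec m j) $ i))\<^sup>2"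
      using mult_unit_vec_index[of i "mat_eval K z" j] Kc[of z] ij by simp
    also have "\<dots> \<le> sq_norm_vec (mat_eval K z *\<^sub>v unit_vec m j)"
      unfolding sq_norm_vec_sum using Kc[of z] ij
      by (intro member_le_sum[of i _ "\<lambda>i. (cmod ((mat_eval K z *\<^sub>v unit_vec m j) $ i))\<^sup>2"]) auto
    also note le
    finally have "(cmod (mat_eval K z $$ (i, j)))\<^sup>2 \<le> 1\<^sup>2" by (simp only: power_one)
    then show "cmod (mat_eval K z $$ (i, j)) \<le> 1" by (rule power2_le_imp_le) (rule zero_le_one)
  next
    fix z assume z: "z \<notin> bad" "- cnj z \<notin> bad"
    have "para_hermitian K z \<in> carrier_mat m q"
      unfolding para_hermitian_def by (rule adjoint_carrier[OF Kc])
    then have c: "para_hermitian K z * mat_eval K z \<in> carrier_mat m m" using Kc by simp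
    show "para_hermitian K z * mat_eval K z = 1\<^sub>m m"
    proof (rule eq_matI)
      fix i j assume "i < dim_row (1\<^sub>m m :: complex mat)" "j < dim_col (1\<^sub>m m :: complex mat)"
      then have ij: "i < m" "j < m" by auto
      have "(para_hermitian K z * mat_eval K z) $$ (i, j)
          = ((para_hermitian K z * mat_eval K z) *\<^sub>v unit_vec m j) \<bullet>c unit_vec m i"
        using cip_unit_vec[OF c ij] by simp
      also have "\<dots> = (mat_eval K z *\<^sub>v unit_vec m j) \<bullet>c (mat_eval K (- cnj z) *\<^sub>v unit_vec m i)"
        using cip_adjoint[of "mat_eval K z *\<^sub>v unit_vec m j" "(mat_eval K (- cnj z))\<^sup>\<dagger>" "unit_vec m i"]
          Kc[of z] Kc[of "- cnj z"] by (simp add: para_hermitian_def mult_mult_vec)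
      also have "\<dots> = unit_vec m j \<bullet>c unit_vec m i"
        using E[OF z, of "unit_vec m j" "unit_vec m i"] by simp
      also have "\<dots> = (1\<^sub>m m :: complex mat) $$ (i, j)"
        using cip_unit_vec[OF one_carrier_mat ij] by (simp add: one_mult_vec)
      finally show "(para_hermitian K z * mat_eval K z) $$ (i, j) = (1\<^sub>m m :: complex mat) $$ (i, j)" .
    qed (use c in auto)
  qed
  then show ?thesis using \<beta> by (auto simp: K_def L_def H'_def)
qed

end
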